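(* On the triangular lattice, the triangle-shaped tetriamond (one unit triangle together with the three unit triangles sharing an edge with it), which has $4$ plaquettes and $N=9$ qubits, is the smallest toric code setup without LC-equivalent local graph state. That is: (i) no graph state that is LC-equivalent to the toric code ground state of the triangle-shaped tetriamond is local with respect to this setup; (ii) every polyiamond with fewer than $4$ triangles or with fewer than $9$ qubits has a toric code ground state that is LC-equivalent to some graph state that is local with respect to that polyiamond.
   Context: A polyiamond is a finite nonempty edge-connected set of unit triangles of the triangular lattice (tiling of the plane by unit equilateral triangles). It defines a toric code setup as follows. Let $\mathcal{L}$ be the plane graph whose vertices and edges are the corners and sides of the triangles of the polyiamond. One qubit is placed on each edge of $\mathcal{L}$. For each vertex $s$ of $\mathcal{L}$ the star operator is $A_s=\prod_{i\ni s}\sigma^x_i$ (product over the edges of $\mathcal{L}$ incident to $s$). For each triangle $p$ of the polyiamond (plaquette) the plaquette operator is $B_p=\prod_{i\in p}\sigma^z_i$ (product over the three sides of $p$); there is no plaquette operator for the outer region. The toric code ground state is the state, unique up to phase, that is fixed by all $A_s$ and by $\prod_{i\in\mathcal{C}}\sigma_i^z$ for every cycle $\mathcal{C}$ of $\mathcal{L}$ (for a polyiamond without holes this is the same as being fixed by all $A_s$ and all $B_p$). Two distinct qubits are vicinal in the setup if both belong to the support of at least one common star operator $A_s$ or plaquette operator $B_p$, i.e. the two edges share a vertex or are sides of the same triangle of the polyiamond. For a simple graph $G$ with neighbourhoods $N_v$, whose vertices are identified with the qubits, the graph state $|G\rangle$ is the state (unique up to phase) fixed by $\sigma^x_v\prod_{w\in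 N_v}\sigma^z_w$ for all vertices $v$. A graph (state) on the qubits of the setup is local with respect to the setup if every edge of $G$ joins two qubits that are vicinal in the setup. The Pauli group $G_1$ is generated by $\sigma^x,\sigma^y,\sigma^z$, the Clifford group is $C_1=\{U\in U(2):UG_1U^\dagger=G_1\}$, and two $N$-qubit states are LC-equivalent if one is obtained from the other by applying an element of $\bigotimes_{i=1}^N C_1^{(i)}$. *)

theory Defs
  imports "HOL-Analysis.Analysis"
begin

section \<open>Pure states of finitely many qubits\<close>

text \<open>The computational basis of the Hilbert space of a finite set \<open>Q\<close> of qubits is indexed by
  the subsets of \<open>Q\<close> (the qubits in state 1); a vector is its family of amplitudes.\<close>

type_synonym 'q qstate = "'q set \<Rightarrow> complex"

definition is_state :: "'q set \<Rightarrow> 'q qstate \<Rightarrow> bool" where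
  "is_state Q \<psi> \<longleftrightarrow> (\<forall>S. \<not> S \<subseteq> Q \<longrightarrow> \<psi> S = 0) \<and> (\<Sum>S\<in>Pow Q. (cmod (\<psi> S))\<^sup>2) = 1"

text \<open>Row and column index \<open>False\<close> stands for the basis vector 0, \<open>True\<close> for 1.\<close>

type_synonym gate = "complex ^ bool ^ bool"

definition sigma_x :: gate where
  "sigma_x = (\<chi> a b. if a = b then 0 else 1)"

definition sigma_y :: gate where
  "sigma_y = (\<chi> a b. if a = b then 0 else if a then \<i> else - \<i>)"

definition sigma_z :: gate where
  "sigma_z = (\<chi> a b. if a = b then (if a then - 1 else 1) else 0)"

definition dagger :: "gate \<Rightarrow> gate" where
  "dagger U = (\<chi> a b. cnj (U $ b $ a))"

text \<open>The generators are involutions, so closing under products already yields the group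
  they generate.\<close>

inductive_set pauli_group :: "gate set" where
  one: "mat 1 \<in> pauli_group"
| x: "sigma_x \<in> pauli_group"
| y: "sigma_y \<in> pauli_group"
| z: "sigma_z \<in> pauli_group"
| mult: "g \<in> pauli_group \<Longrightarrow> h \<in> pauli_group \<Longrightarrow> g ** h \<in> pauli_group"

definition unitary_group :: "gate set" where
  "unitary_group = {U. U ** dagger U = mat 1 \<and> dagger U ** U = mat 1}"

definition clifford_group :: "gate set" where
  "clifford_group = {U \<in> unitary_group. (\<lambda>g. U ** g ** dagger U) ` pauli_group = pauli_group}"

text \<open>The action of the tensor product of the gates \<open>U i\<close>, \<open>i \<in> Q\<close>.\<close>

definition tensor_apply :: "'q set \<Rightarrow> ('q \<Rightarrow> gate) \<Rightarrow> 'q qstate \<Rightarrow> 'q qstate" where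
  "tensor_apply Q U \<psi> =
     (\<lambda>S. if S \<subseteq> Q then \<Sum>T\<in>Pow Q. (\<Prod>i\<in>Q. U i $ (i \<in> S) $ (i \<in> T)) * \<psi> T else 0)"

definition x_on :: "'q set \<Rightarrow> 'q \<Rightarrow> gate" where
  "x_on A i = (if i \<in> A then sigma_x else mat 1)"

definition z_on :: "'q set \<Rightarrow> 'q \<Rightarrow> gate" where
  "z_on A i = (if i \<in> A then sigma_z else mat 1)"

definition LC_equivalent :: "'q set \<Rightarrow> 'q qstate \<Rightarrow> 'q qstate \<Rightarrow> bool" where
  "LC_equivalent Q \<psi> \<phi> \<longleftrightarrow> (\<exists>U. (\<forall>i\<in>Q. U i \<in> clifford_group) \<and> \<phi> = tensor_apply Q U \<psi>)"


section \<open>Graph states\<close>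

text \<open>A simple graph is given by its symmetric adjacency relation, so that the neighbourhood of
  \<open>v\<close> is \<open>E `` {v}\<close>.\<close>

definition simple_graph :: "'q set \<Rightarrow> ('q \<times> 'q) set \<Rightarrow> bool" where
  "simple_graph Q E \<longleftrightarrow> E \<subseteq> Q \<times> Q \<and> sym E \<and> irrefl E"

definition graph_stabilizer :: "('q \<times> 'q) set \<Rightarrow> 'q \<Rightarrow> 'q \<Rightarrow> gate" where
  "graph_stabilizer E v i = x_on {v} i ** z_on (E `` {v}) i"

definition graph_state :: "'q set \<Rightarrow> ('q \<times> 'q) set \<Rightarrow> 'q qstate \<Rightarrow> bool" where
  "graph_state Q E \<phi> \<longleftrightarrow> is_state Q \<phi> \<and> (\<forall>v\<in>Q. tensor_apply Q (graph_stabilizer E v) \<phi> = \<phi>)"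


section \<open>Polyiamonds\<close>

text \<open>The pair \<open>(i, j)\<close> stands for the point \<open>i a + j b\<close>, where \<open>a\<close>, \<open>b\<close> are unit vectors
  enclosing an angle of 60 degrees. Triangles and edges are given by their sets of corners.\<close>

type_synonym point = "int \<times> int"

definition lattice_triangles :: "point set set" where
  "lattice_triangles =
     {{(i, j), (i + 1, j), (i, j + 1)} | i j. True} \<union>
     {{(i + 1, j), (i, j + 1), (i + 1, j + 1)} | i j. True}"

definition sides :: "point set \<Rightarrow> point set set" where
  "sides t = {e. e \<subseteq> t \<and> card e = 2}"

definition edge_adjacent :: "point set \<Rightarrow> point set \<Rightarrow> bool" where
  "edge_adjacent t u \<longleftrightarrow> t \<noteq> u \<and> sides t \<inter> sides u \<noteq> {}"

definition polyiamond :: "point set set \<Rightarrow> bool" where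
  "polyiamond P \<longleftrightarrow> finite P \<and> P \<noteq> {} \<and> P \<subseteq> lattice_triangles \<and>
     (\<forall>t\<in>P. \<forall>u\<in>P. (t, u) \<in> {(a, b). a \<in> P \<and> b \<in> P \<and> edge_adjacent a b}\<^sup>*)"

definition triangle_tetriamond :: "point set \<Rightarrow> point set set" where
  "triangle_tetriamond t = insert t {u \<in> lattice_triangles. edge_adjacent t u}"


section \<open>The toric code setup of a polyiamond\<close>

definition corners :: "point set set \<Rightarrow> point set" where
  "corners P = \<Union>P"

definition qubits :: "point set set \<Rightarrow> point set set" where
  "qubits P = (\<Union>t\<in>P. sides t)"

definition star :: "point set set \<Rightarrow> point \<Rightarrow> point set set" where
  "star P s = {e \<in> qubits P. s \<in> e}"

definition cycle_edges :: "point list \<Rightarrow> point set set" where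
  "cycle_edges vs = {{vs ! k, vs ! (Suc k mod length vs)} | k. k < length vs}"

definition cycles :: "point set set \<Rightarrow> point set set set" where
  "cycles P = {cycle_edges vs | vs. 3 \<le> length vs \<and> distinct vs \<and> cycle_edges vs \<subseteq> qubits P}"

definition toric_ground_state :: "point set set \<Rightarrow> point set qstate \<Rightarrow> bool" where
  "toric_ground_state P \<psi> \<longleftrightarrow> is_state (qubits P) \<psi> \<and>
     (\<forall>s\<in>corners P. tensor_apply (qubits P) (x_on (star P s)) \<psi> = \<psi>) \<and>
     (\<forall>C\<in>cycles P. tensor_apply (qubits P) (z_on C) \<psi> = \<psi>)"

definition vicinal :: "point set set \<Rightarrow> point set \<Rightarrow> point set \<Rightarrow> bool" where
  "vicinal P a b \<longleftrightarrow> a \<noteq> b \<and>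
     ((\<exists>s\<in>corners P. a \<in> star P s \<and> b \<in> star P s) \<or> (\<exists>p\<in>P. a \<in> sides p \<and> b \<in> sides p))"

definition local_graph :: "point set set \<Rightarrow> (point set \<times> point set) set \<Rightarrow> bool" where
  "local_graph P E \<longleftrightarrow> (\<forall>(a, b)\<in>E. vicinal P a b)"


section \<open>Existence of the states\<close>

text \<open>Neither of the two state predicates is vacuous.\<close>

lemma pauli_entry:
  "(x_on A i ** z_on B i) $ a $ b =
     (if (a \<noteq> b) = (i \<in> A) then (if i \<in> B \<and> b then - 1 else 1) else 0)"
  by (cases a; cases b)
    (simp_all add: x_on_def z_on_def sigma_x_def sigma_z_def matrix_matrix_mult_def mat_def UNIV_bool)

lemma tensor_apply_pauli:
  assumes "finite Q" "A \<subseteq> Q" "B \<subseteq> Q" "S \<subseteq> Q"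
  shows "tensor_apply Q (\<lambda>i. x_on A i ** z_on B i) \<psi> S =
           (- 1) ^ card (B \<inter> sym_diff S A) * \<psi> (sym_diff S A)"
proof -
  let ?U = "\<lambda>i. x_on A i ** z_on B i"
  let ?T = "sym_diff S A"
  have T: "?T \<in> Pow Q" using assms by auto
  have z: "(\<Prod>i\<in>Q. ?U i $ (i \<in> S) $ (i \<in> T)) = 0" if "T \<in> Pow Q - {?T}" for T
  proof -
    from that obtain i where "i \<in> T \<longleftrightarrow> i \<notin> ?T" by blast
    moreover from this have "i \<in> Q" using that assms by blast
    ultimately show ?thesis
      using assms(1) by (intro prod_zero bexI[of _ i]) (auto simp: pauli_entry)
  qed
  have v: "(\<Prod>i\<in>Q. ?U i $ (i \<in> S) $ (i \<in> ?T)) = (- 1) ^ card (B \<inter> ?T)"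
  proof -
    have "(\<Prod>i\<in>Q. ?U i $ (i \<in> S) $ (i \<in> ?T)) = (\<Prod>i\<in>Q. if i \<in> B \<inter> ?T then - 1 else 1)"
      by (intro prod.cong) (auto simp: pauli_entry)
    also have "\<dots> = (\<Prod>i\<in>Q \<inter> (B \<inter> ?T). - 1)"
      by (rule prod.inter_restrict[OF assms(1), symmetric])
    also have "Q \<inter> (B \<inter> ?T) = B \<inter> ?T" using assms by auto
    finally show ?thesis by simp
  qed
  have "tensor_apply Q ?U \<psi> S = (\<Sum>T\<in>Pow Q. (\<Prod>i\<in>Q. ?U i $ (i \<in> S) $ (i \<in> T)) * \<psi> T)"
    using assms(4) by (simp add: tensor_apply_def)
  also have "\<dots> = (\<Prod>i\<in>Q. ?U i $ (i \<in> S) $ (i \<in> ?T)) * \<psi> ?T"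
    using assms(1) T z by (subst sum.remove[of _ ?T]) (simp_all del: prod_zero_iff)
  finally show ?thesis using v by simp
qed

lemma tensor_apply_x:
  assumes "finite Q" "A \<subseteq> Q" "S \<subseteq> Q"
  shows "tensor_apply Q (x_on A) \<psi> S = \<psi> (sym_diff S A)"
proof -
  have "x_on A = (\<lambda>i. x_on A i ** z_on {} i)" by (simp add: z_on_def fun_eq_iff)
  then show ?thesis using tensor_apply_pauli[of Q A "{}" S \<psi>] assms by simp
qed

lemma tensor_apply_z:
  assumes "finite Q" "B \<subseteq> Q" "S \<subseteq> Q"
  shows "tensor_apply Q (z_on B) \<psi> S = (- 1) ^ card (B \<inter> S) * \<psi> S"
proof -
  have "z_on B = (\<lambda>i. x_on {} i ** z_on B i)" by (simp add: x_on_def fun_eq_iff)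
  then show ?thesis using tensor_apply_pauli[of Q "{}" B S \<psi>] assms by simp
qed

lemma graph_state_exists:
  assumes fin: "finite Q" and E: "simple_graph Q E"
  shows "\<exists>\<phi>. graph_state Q E \<phi>"
proof -
  define edges where "edges S = {{a, b} | a b. (a, b) \<in> E \<and> a \<in> S \<and> b \<in> S}" for S
  define c where "c = 1 / sqrt (2 ^ card Q)"
  define \<phi> where "\<phi> = (\<lambda>S. if S \<subseteq> Q then complex_of_real c * (- 1) ^ card (edges S) else 0)"
  have sub: "E \<subseteq> Q \<times> Q" and sy: "\<And>a b. (a, b) \<in> E \<Longrightarrow> (b, a) \<in> E" and irr: "\<And>a. (a, a) \<notin> E"
    using E by (auto simp: simple_graph_def sym_def irrefl_def)
  have fine: "finite (edges S)" if "S \<subseteq> Q" for S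
    by (rule finite_subset[of _ "Pow Q"]) (use that fin in \<open>auto simp: edges_def\<close>)
  have ins: "card (edges (insert v S)) = card (edges S) + card (E `` {v} \<inter> S)"
    if "insert v S \<subseteq> Q" "v \<notin> S" for v S
  proof -
    have eq: "edges (insert v S) = edges S \<union> (\<lambda>w. {v, w}) ` (E `` {v} \<inter> S)"
      using irr sy unfolding edges_def by (auto simp: insert_commute)
    have dis: "edges S \<inter> (\<lambda>w. {v, w}) ` (E `` {v} \<inter> S) = {}"
      using that(2) unfolding edges_def by (auto simp: doubleton_eq_iff)
    have "inj_on (\<lambda>w. {v, w}) (E `` {v} \<inter> S)"
      by (auto simp: inj_on_def doubleton_eq_iff)
    moreover have "finite (E `` {v} \<inter> S)" using finite_subset[OF _ fin, of S] that(1) by simp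
    ultimately show ?thesis
      unfolding eq using dis fine[of S] that(1) by (subst card_Un_disjoint) (simp_all add: card_image)
  qed
  have "is_state Q \<phi>"
  proof -
    have "(\<Sum>S\<in>Pow Q. (cmod (\<phi> S))\<^sup>2) = (\<Sum>S\<in>Pow Q. c\<^sup>2)"
      by (intro sum.cong) (auto simp: \<phi>_def norm_mult norm_power)
    also have "\<dots> = 1" using fin by (simp add: card_Pow c_def power_divide)
    finally show ?thesis by (auto simp: is_state_def \<phi>_def)
  qed
  moreover have "tensor_apply Q (graph_stabilizer E v) \<phi> = \<phi>" if v: "v \<in> Q" for v
  proof
    fix S
    show "tensor_apply Q (graph_stabilizer E v) \<phi> S = \<phi> S"
    proof (cases "S \<subseteq> Q")
      case False
      then show ?thesis by (simp add: tensor_apply_def \<phi>_def)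
    next
      case True
      have "tensor_apply Q (graph_stabilizer E v) \<phi> S =
          (- 1) ^ card (E `` {v} \<inter> sym_diff S {v}) * \<phi> (sym_diff S {v})"
        using tensor_apply_pauli[of Q "{v}" "E `` {v}" S \<phi>] fin v sub True
        by (auto simp: graph_stabilizer_def[abs_def])
      also have "\<dots> = \<phi> S"
      proof (cases "v \<in> S")
        case True
        then obtain R where R: "S = insert v R" "v \<notin> R" by (metis Set.set_insert)
        then have "sym_diff S {v} = R" by auto
        then show ?thesis using ins[of v R] R \<open>S \<subseteq> Q\<close>
          by (simp add: \<phi>_def power_add)
      next
        case False
        then have "sym_diff S {v} = insert v S" by auto
        moreover have "E `` {v} \<inter> insert v S = E `` {v} \<inter> S" using irr by auto
        ultimately show ?thesis using ins[of v S] False True v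
          by (simp add: \<phi>_def power_add flip: power_mult_distrib)
      qed
      finally show ?thesis .
    qed
  qed
  ultimately show ?thesis unfolding graph_state_def by blast
qed

lemma qubits_doubleton:
  assumes "polyiamond P" "e \<in> qubits P"
  obtains a b where "e = {a, b}" "a \<noteq> b"
  using assms by (auto simp: qubits_def sides_def card_2_iff)

lemma finite_qubits:
  assumes "polyiamond P"
  shows "finite (qubits P)"
proof -
  have "finite t" if "t \<in> P" for t
    using that assms by (auto simp: polyiamond_def lattice_triangles_def)
  then show ?thesis
    using assms by (auto simp: polyiamond_def qubits_def sides_def)
qed

lemma even_sign_changes:
  "even (card {k. k < n \<and> f k \<noteq> f (Suc k)}) \<longleftrightarrow> f 0 = (f n :: bool)"
proof (induction n)
  case (Suc n)
  have "{k. k < Suc n \<and> f k \<noteq> f (Suc k)} =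
      (if f n \<noteq> f (Suc n) then insert n {k. k < n \<and> f k \<noteq> f (Suc k)}
       else {k. k < n \<and> f k \<noteq> f (Suc k)})"
    by (auto simp: less_Suc_eq)
  then show ?case using Suc by auto
qed simp

lemma no_two_cycle:
  fixes j k n :: nat
  assumes "3 \<le> n" "j = (if Suc k = n then 0 else Suc k)" "k = (if Suc j = n then 0 else Suc j)"
  shows "j = k"
proof -
  have "Suc k = n \<and> j = 0 \<or> j = Suc k" "Suc j = n \<and> k = 0 \<or> k = Suc j"
    using assms(2,3) by metis+
  then show ?thesis using assms(1) by linarith
qed

lemma cycle_cut_even:
  assumes "3 \<le> length vs" "distinct vs" "\<And>e. e \<in> cycle_edges vs \<Longrightarrow> e \<in> D \<longleftrightarrow> odd (card (e \<inter> W))"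
  shows "even (card (cycle_edges vs \<inter> D))"
proof -
  let ?n = "length vs"
  define g where "g k = {vs ! k, vs ! (Suc k mod ?n)}" for k
  define f where "f k = (vs ! (k mod ?n) \<in> W)" for k
  have md: "Suc k mod ?n = (if Suc k = ?n then 0 else Suc k)" if "k < ?n" for k
    using that by simp
  have inj: "inj_on g {..<?n}"
  proof (rule inj_onI)
    fix j k assume "j \<in> {..<?n}" "k \<in> {..<?n}" and g: "g j = g k"
    then have jk: "j < ?n" "k < ?n" by simp_all
    have lt: "Suc i mod ?n < ?n" for i using jk(1) by (intro mod_less_divisor) linarith
    have "vs ! j = vs ! k \<or> vs ! j = vs ! (Suc k mod ?n) \<and> vs ! k = vs ! (Suc j mod ?n)"
      using g unfolding g_def doubleton_eq_iff by metis
    then have "j = k \<or> j = Suc k mod ?n \<and> k = Suc j mod ?n"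
      using jk lt[of j] lt[of k] by (simp only: nth_eq_iff_index_eq[OF assms(2)])
    then show "j = k"
      unfolding md[OF jk(1)] md[OF jk(2)] using no_two_cycle[OF assms(1)] by blast
  qed
  have D: "g k \<in> D \<longleftrightarrow> f k \<noteq> f (Suc k)" if "k < ?n" for k
  proof -
    have "vs ! k \<noteq> vs ! (Suc k mod ?n)"
    proof -
      have "Suc k mod ?n < ?n" using that by (intro mod_less_divisor) linarith
      moreover have "Suc k mod ?n \<noteq> k" using md[OF that] assms(1) by (auto split: if_splits)
      ultimately show ?thesis using that by (simp add: nth_eq_iff_index_eq[OF assms(2)])
    qed
    moreover have "g k \<in> cycle_edges vs" using that by (auto simp: g_def cycle_edges_def)
    ultimately show ?thesis using that assms(3)[of "g k"]
      by (auto simp: g_def f_def Int_insert_left)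
  qed
  have "cycle_edges vs \<inter> D = g ` {k. k < ?n \<and> f k \<noteq> f (Suc k)}"
    using D by (auto simp: cycle_edges_def g_def)
  moreover have "inj_on g {k. k < ?n \<and> f k \<noteq> f (Suc k)}"
    using inj by (rule inj_on_subset) auto
  ultimately show ?thesis
    using even_sign_changes[of ?n f] by (simp only: card_image) (simp add: f_def)
qed

lemma toric_ground_state_exists:
  assumes P: "polyiamond P"
  shows "\<exists>\<psi>. toric_ground_state P \<psi>"
proof -
  let ?Q = "qubits P"
  define cut where "cut W = {e \<in> ?Q. odd (card (e \<inter> W))}" for W
  define c where "c = 1 / sqrt (real (card (range cut)))"
  define \<psi> where "\<psi> = (\<lambda>S. if S \<in> range cut then complex_of_real c else 0)"
  have fin: "finite ?Q" using finite_qubits P by blast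
  have sub: "range cut \<subseteq> Pow ?Q" by (auto simp: cut_def)
  then have finc: "finite (range cut)" using fin by (simp add: finite_subset)
  then have pos: "card (range cut) > 0" by (simp add: card_gt_0_iff)
  have star: "sym_diff (cut W) (star P s) = cut (sym_diff W {s})" for W s
  proof -
    have "odd (card (e \<inter> sym_diff W {s})) \<longleftrightarrow> (odd (card (e \<inter> W)) \<longleftrightarrow> s \<notin> e)" if e: "e \<in> ?Q" for e
    proof -
      obtain a b where "e = {a, b}" "a \<noteq> b" using qubits_doubleton[OF P e] by blast
      then show ?thesis by (auto simp: Int_insert_left)
    qed
    then show ?thesis by (auto simp: cut_def star_def)
  qed
  have "is_state ?Q \<psi>"
  proof -
    have "(\<Sum>S\<in>Pow ?Q. (cmod (\<psi> S))\<^sup>2) = (\<Sum>S\<in>range cut. c\<^sup>2)"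
      by (rule sum.mono_neutral_cong_right) (use fin sub in \<open>auto simp: \<psi>_def\<close>)
    also have "\<dots> = 1" using pos by (simp add: c_def power_divide)
    finally show ?thesis using sub by (auto simp: is_state_def \<psi>_def)
  qed
  moreover have "tensor_apply ?Q (x_on (star P s)) \<psi> = \<psi>" for s
  proof
    fix S
    show "tensor_apply ?Q (x_on (star P s)) \<psi> S = \<psi> S"
    proof (cases "S \<subseteq> ?Q")
      case False
      then show ?thesis using sub by (auto simp: tensor_apply_def \<psi>_def)
    next
      case True
      have "star P s \<subseteq> ?Q" by (auto simp: star_def)
      moreover have "sym_diff S (star P s) \<in> range cut \<longleftrightarrow> S \<in> range cut"
      proof
        assume "sym_diff S (star P s) \<in> range cut"
        then obtain W where "sym_diff S (star P s) = cut W" by auto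
        then have "sym_diff (cut W) (star P s) = S" by blast
        then show "S \<in> range cut" using star by (metis rangeI)
      next
        assume "S \<in> range cut"
        then obtain W where "S = cut W" by auto
        then show "sym_diff S (star P s) \<in> range cut" using star[of W s] by simp
      qed
      ultimately show ?thesis using True fin by (simp add: tensor_apply_x \<psi>_def)
    qed
  qed
  moreover have "tensor_apply ?Q (z_on C) \<psi> = \<psi>" if C: "C \<in> cycles P" for C
  proof
    fix S
    obtain vs where vs: "C = cycle_edges vs" "3 \<le> length vs" "distinct vs" "C \<subseteq> ?Q"
      using C by (auto simp: cycles_def)
    have "even (card (C \<inter> cut W))" for W
      unfolding vs(1) by (rule cycle_cut_even[of _ _ W]) (use vs in \<open>auto simp: cut_def\<close>)
    then have "(- 1) ^ card (C \<inter> S) * \<psi> S = \<psi> S"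
      by (auto simp: \<psi>_def)
    moreover have "\<psi> S = 0" if "\<not> S \<subseteq> ?Q"
      using that sub by (auto simp: \<psi>_def)
    ultimately show "tensor_apply ?Q (z_on C) \<psi> S = \<psi> S"
      using tensor_apply_z[OF fin vs(4)] by (cases "S \<subseteq> ?Q") (simp_all add: tensor_apply_def)
  qed
  ultimately show ?thesis unfolding toric_ground_state_def by blast
qed

end

theory Submission imports Defs
begin

text \<open>A local Clifford map to a graph state \<open>(N)\<close> induces at every qubit a permutation of the
  Paulis modulo scalars, and every stabilizer of the toric state becomes, up to a scalar, a Pauli
  string \<open>X\<^sub>A Z\<^sub>B\<close> that stabilizes the graph state; commuting with the generators of the graph state
  forces \<open>B = N(A)\<close> over GF(2).

  For the tetriamond, group each central side \<open>c\<close> with the two outer sides of its outer triangle.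
  The star of the outer corner and the outer plaquette show that the graph joins each group to the
  other qubits through a matrix of rank at most one. If a group is joined to both other groups,
  locality leaves only \<open>c\<close> as its contact, and then the Pauli Z on \<open>c\<close> becomes a Pauli Z again. If
  this happened for all three groups, the central plaquette would become a Z-string, which stabilizes no
  graph state. The remaining configurations, a group joined to no other or two groups joined only
  through the third, contradict the central plaquette together with a star of the central triangle.

  Conversely, fewer than four triangles, or fewer than nine edges, force all triangles to share a
  corner, and then the edges at that corner are a spanning tree with local fundamental cycles.\<close>

section \<open>Products of local operators\<close>

lemma gate_mult_entry:
  "((g :: gate) ** h) $ a $ b = g $ a $ True * h $ True $ b + g $ a $ False * h $ False $ b"
  by (simp add: matrix_matrix_mult_def UNIV_bool add.commute)

lemma gate_eq_iff:
  "(g :: gate) = h \<longleftrightarrow> g $ True $ True = h $ True $ True \<and> g $ True $ False = h $ True $ False \<and>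
     g $ False $ True = h $ False $ True \<and> g $ False $ False = h $ False $ False"
  by (auto simp: vec_eq_iff all_bool_eq)

lemma tensor_apply_cong:
  assumes "\<And>i. i \<in> Q \<Longrightarrow> U i = V i"
  shows "tensor_apply Q U \<psi> = tensor_apply Q V \<psi>"
  unfolding tensor_apply_def using assms by (auto simp: fun_eq_iff intro!: sum.cong prod.cong)

text \<open>Distributing the product over the two-term entries of \<open>U i ** V i\<close> leaves a
  sum over subsets \<open>T\<close> of \<open>Q\<close>, and these are exactly the intermediate
  basis vectors of the matrix product.\<close>

lemma tensor_apply_compose:
  assumes "finite Q"
  shows "tensor_apply Q U (tensor_apply Q V \<psi>) = tensor_apply Q (\<lambda>i. U i ** V i) \<psi>"
proof
  fix S
  have entry: "(\<Prod>i\<in>Q. (U i ** V i) $ (i \<in> S) $ (i \<in> R)) =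
      (\<Sum>T\<in>Pow Q. (\<Prod>i\<in>Q. U i $ (i \<in> S) $ (i \<in> T)) * (\<Prod>i\<in>Q. V i $ (i \<in> T) $ (i \<in> R)))" for R
  proof -
    have "(\<Prod>i\<in>Q. (U i ** V i) $ (i \<in> S) $ (i \<in> R)) =
        (\<Sum>T\<in>Pow Q. (\<Prod>i\<in>T. U i $ (i \<in> S) $ True * V i $ True $ (i \<in> R)) *
           (\<Prod>i\<in>Q - T. U i $ (i \<in> S) $ False * V i $ False $ (i \<in> R)))"
      by (simp only: gate_mult_entry prod_add[OF assms])
    also have "\<dots> = (\<Sum>T\<in>Pow Q. \<Prod>i\<in>Q. U i $ (i \<in> S) $ (i \<in> T) * V i $ (i \<in> T) $ (i \<in> R))"
    proof (rule sum.cong[OF refl])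
      fix T assume "T \<in> Pow Q"
      then have Q: "Q = T \<union> (Q - T)" and fin: "finite T" using assms by (auto intro: finite_subset)
      have "(\<Prod>i\<in>Q. U i $ (i \<in> S) $ (i \<in> T) * V i $ (i \<in> T) $ (i \<in> R)) =
          (\<Prod>i\<in>T. U i $ (i \<in> S) $ (i \<in> T) * V i $ (i \<in> T) $ (i \<in> R)) *
          (\<Prod>i\<in>Q - T. U i $ (i \<in> S) $ (i \<in> T) * V i $ (i \<in> T) $ (i \<in> R))"
        by (subst (1) Q, rule prod.union_disjoint) (use assms fin in auto)
      then show "(\<Prod>i\<in>T. U i $ (i \<in> S) $ True * V i $ True $ (i \<in> R)) *
           (\<Prod>i\<in>Q - T. U i $ (i \<in> S) $ False * V i $ False $ (i \<in> R)) =
         (\<Prod>i\<in>Q. U i $ (i \<in> S) $ (i \<in> T) * V i $ (i \<in> T) $ (i \<in> R))"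
        by simp
    qed
    finally show ?thesis by (simp add: prod.distrib)
  qed
  show "tensor_apply Q U (tensor_apply Q V \<psi>) S = tensor_apply Q (\<lambda>i. U i ** V i) \<psi> S"
  proof (cases "S \<subseteq> Q")
    case True
    have "tensor_apply Q U (tensor_apply Q V \<psi>) S =
        (\<Sum>T\<in>Pow Q. \<Sum>R\<in>Pow Q. (\<Prod>i\<in>Q. U i $ (i \<in> S) $ (i \<in> T)) *
           (\<Prod>i\<in>Q. V i $ (i \<in> T) $ (i \<in> R)) * \<psi> R)"
      using True by (simp add: tensor_apply_def sum_distrib_left mult.assoc)
    also have "\<dots> = tensor_apply Q (\<lambda>i. U i ** V i) \<psi> S"
      using True by (subst sum.swap) (simp add: tensor_apply_def entry sum_distrib_right)
    finally show ?thesis .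
  qed (simp add: tensor_apply_def)
qed

lemma tensor_apply_scaled:
  "tensor_apply Q (\<lambda>i. mat (\<omega> i) ** U i) \<psi> = (\<lambda>S. (\<Prod>i\<in>Q. \<omega> i) * tensor_apply Q U \<psi> S)"
proof -
  have "(mat k ** g) $ a $ b = k * g $ a $ b" for k a b and g :: gate
    by (cases a) (simp_all add: gate_mult_entry mat_def)
  then show ?thesis
    by (simp add: tensor_apply_def prod.distrib sum_distrib_left mult.assoc fun_eq_iff)
qed

lemma tensor_apply_one:
  assumes "finite Q" "S \<subseteq> Q"
  shows "tensor_apply Q (\<lambda>i. mat 1) \<psi> S = \<psi> S"
  using tensor_apply_x[OF assms(1) _ assms(2), of "{}" \<psi>] by (simp add: x_on_def[abs_def])

text \<open>Moving the operator across the inner product reduces preservation of the norm to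
  \<open>dagger (U i) ** U i = mat 1\<close> at each qubit.\<close>

lemma tensor_apply_adjoint:
  assumes "finite Q"
  shows "(\<Sum>S\<in>Pow Q. tensor_apply Q U \<psi> S * cnj (\<xi> S)) =
    (\<Sum>S\<in>Pow Q. \<psi> S * cnj (tensor_apply Q (\<lambda>i. dagger (U i)) \<xi> S))"
proof -
  have "(\<Sum>S\<in>Pow Q. tensor_apply Q U \<psi> S * cnj (\<xi> S)) =
      (\<Sum>S\<in>Pow Q. \<Sum>T\<in>Pow Q. (\<Prod>i\<in>Q. U i $ (i \<in> S) $ (i \<in> T)) * \<psi> T * cnj (\<xi> S))"
    by (rule sum.cong) (simp_all add: tensor_apply_def sum_distrib_right)
  also have "\<dots> = (\<Sum>T\<in>Pow Q. \<Sum>S\<in>Pow Q. (\<Prod>i\<in>Q. U i $ (i \<in> S) $ (i \<in> T)) * \<psi> T * cnj (\<xi> S))"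
    by (rule sum.swap)
  also have "\<dots> = (\<Sum>T\<in>Pow Q. \<psi> T * cnj (tensor_apply Q (\<lambda>i. dagger (U i)) \<xi> T))"
    by (rule sum.cong)
      (simp_all add: tensor_apply_def dagger_def sum_distrib_left mult.assoc mult.left_commute)
  finally show ?thesis .
qed

lemma is_state_tensor_apply:
  assumes fin: "finite Q" and U: "\<And>i. i \<in> Q \<Longrightarrow> U i \<in> unitary_group" and \<psi>: "is_state Q \<psi>"
  shows "is_state Q (tensor_apply Q U \<psi>)"
proof -
  have "complex_of_real (\<Sum>S\<in>Pow Q. (cmod (tensor_apply Q U \<psi> S))\<^sup>2) =
      (\<Sum>S\<in>Pow Q. \<psi> S * cnj (tensor_apply Q (\<lambda>i. dagger (U i) ** U i) \<psi> S))"
    by (simp add: complex_norm_square tensor_apply_adjoint[OF fin] tensor_apply_compose[OF fin]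
        del: of_real_power)
  also have "tensor_apply Q (\<lambda>i. dagger (U i) ** U i) \<psi> = tensor_apply Q (\<lambda>i. mat 1) \<psi>"
    by (rule tensor_apply_cong) (use U in \<open>auto simp: unitary_group_def\<close>)
  also have "(\<Sum>S\<in>Pow Q. \<psi> S * cnj (tensor_apply Q (\<lambda>i. mat 1) \<psi> S)) =
      complex_of_real (\<Sum>S\<in>Pow Q. (cmod (\<psi> S))\<^sup>2)"
    by (simp add: complex_norm_square tensor_apply_one[OF fin] del: of_real_power)
  also have "\<dots> = complex_of_real 1" using \<psi> by (simp add: is_state_def)
  finally have "(\<Sum>S\<in>Pow Q. (cmod (tensor_apply Q U \<psi> S))\<^sup>2) = 1" by (simp only: of_real_eq_iff)
  then show ?thesis by (auto simp: is_state_def tensor_apply_def)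
qed

lemma is_state_nonzero:
  assumes "is_state Q \<psi>"
  obtains S where "S \<subseteq> Q" "\<psi> S \<noteq> 0"
proof -
  have "\<exists>S\<in>Pow Q. \<psi> S \<noteq> 0"
  proof (rule ccontr)
    assume "\<not> ?thesis"
    then have "(\<Sum>S\<in>Pow Q. (cmod (\<psi> S))\<^sup>2) = 0" by (intro sum.neutral) auto
    then show False using assms by (simp add: is_state_def)
  qed
  then show ?thesis using that by blast
qed

section \<open>Stabilizers\<close>

lemma odd_card_sym_diff:
  assumes "finite A" "finite B"
  shows "odd (card (sym_diff A B)) \<longleftrightarrow> (odd (card A) \<noteq> odd (card B))"
proof -
  have "card A = card (A - B) + card (A \<inter> B)" "card B = card (B - A) + card (A \<inter> B)"
    using assms by (metis card_Diff_subset_Int card_mono finite_Int inf_le1 le_add_diff_inverse2)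
      (metis assms(2) card_Diff_subset_Int card_mono finite_Int inf_le1 inf_commute le_add_diff_inverse2)
  moreover have "card (sym_diff A B) = card (A - B) + card (B - A)"
    using assms by (intro card_Un_disjoint) auto
  ultimately show ?thesis by auto
qed

text \<open>Two Pauli strings commute or anticommute, and anticommuting ones have no common
  eigenvector with nonzero eigenvalues. The two parities count the signs from moving Z past
  X.\<close>

lemma common_eigenstate_commute:
  assumes fin: "finite Q" and \<phi>: "is_state Q \<phi>"
    and sub: "A \<subseteq> Q" "B \<subseteq> Q" "C \<subseteq> Q" "D \<subseteq> Q"
    and AB: "tensor_apply Q (\<lambda>i. x_on A i ** z_on B i) \<phi> = (\<lambda>S. k * \<phi> S)" and k: "k \<noteq> 0"
    and CD: "tensor_apply Q (\<lambda>i. x_on C i ** z_on D i) \<phi> = \<phi>"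
  shows "odd (card (A \<inter> D)) \<longleftrightarrow> odd (card (B \<inter> C))"
proof -
  obtain S where S: "S \<subseteq> Q" "\<phi> S \<noteq> 0" using is_state_nonzero[OF \<phi>] by blast
  let ?R = "sym_diff (sym_diff S A) C"
  have swap: "sym_diff (sym_diff S C) A = ?R" by blast
  have SQ: "sym_diff S A \<subseteq> Q" "sym_diff S C \<subseteq> Q" "?R \<subseteq> Q" using S sub by auto
  have f: "finite X" if "X \<subseteq> Q" for X using that fin by (rule finite_subset)
  have CD': "\<phi> T = (- 1) ^ card (D \<inter> sym_diff T C) * \<phi> (sym_diff T C)" if "T \<subseteq> Q" for T
    using tensor_apply_pauli[OF fin sub(3,4) that, of \<phi>] CD by simp
  have AB': "k * \<phi> T = (- 1) ^ card (B \<inter> sym_diff T A) * \<phi> (sym_diff T A)" if "T \<subseteq> Q" for T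
    using tensor_apply_pauli[OF fin sub(1,2) that, of \<phi>] AB by (simp add: fun_eq_iff)
  \<comment> \<open>Applying the two strings in either order links the amplitudes at
    \<open>S\<close> and \<open>?R\<close>. As these do not vanish, the two signs must
    coincide.\<close>
  have 1: "k * \<phi> S = (- 1) ^ (card (B \<inter> sym_diff S A) + card (D \<inter> ?R)) * \<phi> ?R"
    using AB'[OF S(1)] CD'[OF SQ(1)] by (simp add: power_add)
  have 2: "k * \<phi> S = (- 1) ^ (card (D \<inter> sym_diff S C) + card (B \<inter> ?R)) * \<phi> ?R"
    using CD'[OF S(1)] AB'[OF SQ(2)] unfolding swap by (simp add: power_add mult.left_commute)
  have R: "\<phi> ?R \<noteq> 0" using 1 S k by auto
  have par: "odd (card (X \<inter> sym_diff T Y)) \<longleftrightarrow> (odd (card (X \<inter> T)) \<noteq> odd (card (X \<inter> Y)))"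
    if "X \<subseteq> Q" "T \<subseteq> Q" for X T Y
  proof -
    have "X \<inter> sym_diff T Y = sym_diff (X \<inter> T) (X \<inter> Y)" by blast
    then show ?thesis using odd_card_sym_diff[of "X \<inter> T" "X \<inter> Y"] f[OF that(1)] by simp
  qed
  have "(- 1 :: complex) ^ (card (B \<inter> sym_diff S A) + card (D \<inter> ?R)) =
      (- 1) ^ (card (D \<inter> sym_diff S C) + card (B \<inter> ?R))"
    using 1 2 R by simp
  then have "even (card (B \<inter> sym_diff S A) + card (D \<inter> ?R)) \<longleftrightarrow>
      even (card (D \<inter> sym_diff S C) + card (B \<inter> ?R))"
    by (auto simp: minus_one_power_iff split: if_splits)
  then have "(odd (card (D \<inter> A)) \<longleftrightarrow> odd (card (B \<inter> C)))"
    using par[OF sub(2) SQ(1), of C] par[OF sub(4) SQ(1), of C] par[OF sub(4) S(1), of A]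
      par[OF sub(4) S(1), of C]
    by auto
  then show ?thesis by (simp add: Int_commute)
qed

text \<open>Commutation with the generator at \<open>v\<close>, whose X part is \<open>{v}\<close>
  and whose Z part is the neighbourhood of \<open>v\<close>. Over GF(2), the Z part of a stabilizer
  is thus the adjacency matrix applied to its X part.\<close>

lemma graph_state_stabilizer:
  assumes fin: "finite Q" and E: "simple_graph Q E" and \<phi>: "graph_state Q E \<phi>"
    and "A \<subseteq> Q" "B \<subseteq> Q" "k \<noteq> 0"
    and "tensor_apply Q (\<lambda>i. x_on A i ** z_on B i) \<phi> = (\<lambda>S. k * \<phi> S)" and v: "v \<in> Q"
  shows "v \<in> B \<longleftrightarrow> odd (card (E `` {v} \<inter> A))"
proof -
  have "E `` {v} \<subseteq> Q" using E by (auto simp: simple_graph_def)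
  then have "odd (card (A \<inter> E `` {v})) \<longleftrightarrow> odd (card (B \<inter> {v}))"
    using common_eigenstate_commute[OF fin _ assms(4,5) _ _ assms(7,6), of "{v}" "E `` {v}"] \<phi> v
    by (simp add: graph_state_def graph_stabilizer_def[abs_def])
  then show ?thesis by (cases "v \<in> B") (simp_all add: Int_commute)
qed

section \<open>Clifford gates\<close>

text \<open>Two bits name a Pauli modulo scalars, so that products add the bits over GF(2);
  \<open>sigma_y\<close> is \<open>\<i>\<close> times \<open>pauli True True\<close>.\<close>

definition pauli :: "bool \<Rightarrow> bool \<Rightarrow> gate" where
  "pauli a b = (if a then sigma_x else mat 1) ** (if b then sigma_z else mat 1)"

lemma pauli_simps:
  "pauli False False = mat 1" "pauli True False = sigma_x" "pauli False True = sigma_z"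
  by (simp_all add: pauli_def)

lemma pauli_on: "pauli (i \<in> A) (i \<in> B) = x_on A i ** z_on B i"
  by (simp add: pauli_def x_on_def z_on_def)

lemmas gate_simps = gate_eq_iff gate_mult_entry sigma_x_def sigma_y_def sigma_z_def mat_def pauli_def

lemma pauli_mult:
  "pauli a b ** pauli a' b' = mat (if b \<and> a' then - 1 else 1) ** pauli (a \<noteq> a') (b \<noteq> b')"
  by (cases a; cases b; cases a'; cases b') (simp_all add: gate_simps)

lemma mat_mult_scaled:
  "(mat k ** g) ** (mat l ** h) = mat (k * l) ** ((g :: gate) ** (h :: gate))"
  by (simp add: gate_simps algebra_simps)

lemma mat_mult_mat: "mat k ** mat l = (mat (k * l) :: gate)"
  by (simp add: gate_simps)

lemma pauli_group_form:
  assumes "g \<in> pauli_group"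
  obtains \<omega> a b where "\<omega> \<noteq> 0" "g = mat \<omega> ** pauli a b"
  using assms
proof (induction arbitrary: thesis)
  case one
  show ?case by (rule one.prems[of 1 False False]) (simp_all add: gate_simps)
next
  case x
  show ?case by (rule x.prems[of 1 True False]) (simp_all add: gate_simps)
next
  case y
  show ?case by (rule y.prems[of \<i> True True]) (simp_all add: gate_simps)
next
  case z
  show ?case by (rule z.prems[of 1 False True]) (simp_all add: gate_simps)
next
  case (mult g h)
  obtain \<omega> a b where g: "\<omega> \<noteq> 0" "g = mat \<omega> ** pauli a b" using mult.IH(1) by blast
  obtain \<omega>' a' b' where h: "\<omega>' \<noteq> 0" "h = mat \<omega>' ** pauli a' b'" using mult.IH(2) by blast
  let ?s = "(if b \<and> a' then - 1 else 1) :: complex"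
  have "g ** h = mat (\<omega> * \<omega>') ** (pauli a b ** pauli a' b')"
    by (simp only: g h mat_mult_scaled)
  also have "\<dots> = mat (\<omega> * \<omega>' * ?s) ** pauli (a \<noteq> a') (b \<noteq> b')"
    by (simp only: pauli_mult mat_mult_mat matrix_mul_assoc)
  finally show ?case using g(1) h(1) by (intro mult.prems[of "\<omega> * \<omega>' * ?s"]) auto
qed

lemma pauli_anticommute:
  "pauli a b ** pauli a' b' = pauli a' b' ** pauli a b \<longleftrightarrow> (a \<and> b') = (b \<and> a')"
  by (cases a; cases b; cases a'; cases b') (simp_all add: gate_simps)

text \<open>The intertwining form, without the adjoint on the right, lets a gate be pushed past a
  Pauli inside \<open>tensor_apply\<close>.\<close>

lemma clifford_conjugation:
  assumes U: "U \<in> clifford_group"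
  obtains \<omega> a b where "\<omega> \<noteq> 0" "U ** pauli p q = mat \<omega> ** pauli a b ** U"
proof -
  have pq: "pauli p q \<in> pauli_group"
    by (cases p; cases q) (auto simp: pauli_def intro: pauli_group.intros)
  have un: "dagger U ** U = mat 1" using U by (simp add: clifford_group_def unitary_group_def)
  have "U ** pauli p q ** dagger U \<in> pauli_group"
    using U pq unfolding clifford_group_def by blast
  then obtain \<omega> a b where w: "\<omega> \<noteq> 0" and e: "U ** pauli p q ** dagger U = mat \<omega> ** pauli a b"
    by (rule pauli_group_form)
  have "U ** pauli p q = (U ** pauli p q ** dagger U) ** U"
    by (simp add: un flip: matrix_mul_assoc)
  then show ?thesis using that[OF w] by (simp add: e)
qed

text \<open>The bits \<open>(\<alpha>, \<gamma>)\<close> and \<open>(\<beta>, \<delta>)\<close> are the images of X and Z in the quotient of the Pauli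
  group by the scalars; the last clause says that these images anticommute.\<close>

lemma clifford_symplectic:
  assumes U: "U \<in> clifford_group"
  obtains \<omega> \<omega>' \<alpha> \<beta> \<gamma> \<delta> where "\<omega> \<noteq> 0" "U ** sigma_x = mat \<omega> ** pauli \<alpha> \<gamma> ** U"
    "\<omega>' \<noteq> 0" "U ** sigma_z = mat \<omega>' ** pauli \<beta> \<delta> ** U" "(\<alpha> \<and> \<delta>) \<noteq> (\<beta> \<and> \<gamma>)"
proof -
  obtain \<omega> \<alpha> \<gamma> where x: "\<omega> \<noteq> 0" "U ** sigma_x = mat \<omega> ** pauli \<alpha> \<gamma> ** U"
    using clifford_conjugation[OF U, of True False] unfolding pauli_simps by blast
  obtain \<omega>' \<beta> \<delta> where z: "\<omega>' \<noteq> 0" "U ** sigma_z = mat \<omega>' ** pauli \<beta> \<delta> ** U"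
    using clifford_conjugation[OF U, of False True] unfolding pauli_simps by blast
  have un: "dagger U ** U = mat 1" using U by (simp add: clifford_group_def unitary_group_def)
  have "(\<alpha> \<and> \<delta>) \<noteq> (\<beta> \<and> \<gamma>)"
  proof
    assume "(\<alpha> \<and> \<delta>) = (\<beta> \<and> \<gamma>)"
    then have c: "pauli \<alpha> \<gamma> ** pauli \<beta> \<delta> = pauli \<beta> \<delta> ** pauli \<alpha> \<gamma>"
      by (simp add: pauli_anticommute conj_commute)
    \<comment> \<open>If the images commuted, pushing \<open>U\<close> through XZ and through ZX
      would give the same gate; cancelling \<open>U\<close> would make X and Z commute.\<close>
    have "U ** (sigma_x ** sigma_z) = mat \<omega> ** pauli \<alpha> \<gamma> ** (U ** sigma_z)"
      by (simp only: matrix_mul_assoc x(2))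
    also have "\<dots> = mat \<omega> ** pauli \<alpha> \<gamma> ** (mat \<omega>' ** pauli \<beta> \<delta>) ** U"
      by (simp only: matrix_mul_assoc z(2))
    also have "\<dots> = mat \<omega>' ** pauli \<beta> \<delta> ** (mat \<omega> ** pauli \<alpha> \<gamma>) ** U"
      by (simp only: mat_mult_scaled c mult.commute)
    also have "\<dots> = mat \<omega>' ** pauli \<beta> \<delta> ** (U ** sigma_x)"
      by (simp only: matrix_mul_assoc x(2))
    also have "\<dots> = U ** (sigma_z ** sigma_x)"
      by (simp only: matrix_mul_assoc z(2))
    finally have "dagger U ** U ** (sigma_x ** sigma_z) = dagger U ** U ** (sigma_z ** sigma_x)"
      by (simp only: flip: matrix_mul_assoc)
    then have "sigma_x ** sigma_z = sigma_z ** sigma_x" unfolding un by simp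
    then show False by (simp add: gate_simps)
  qed
  then show ?thesis using that x z by blast
qed

section \<open>The Hadamard gate and the identity as Clifford gates\<close>

definition hadamard :: gate where
  "hadamard = (\<chi> a b. if a \<and> b then - complex_of_real (1 / sqrt 2) else complex_of_real (1 / sqrt 2))"

lemma half: "complex_of_real (1 / sqrt 2) * complex_of_real (1 / sqrt 2) = 1 / 2"
  by (simp flip: of_real_mult add: real_divide_square_eq)

lemma hadamard_dagger: "dagger hadamard = hadamard"
  by (simp add: gate_simps hadamard_def dagger_def)

lemma hadamard_entries:
  "hadamard $ True $ True = - complex_of_real (1 / sqrt 2)"
  "hadamard $ True $ False = complex_of_real (1 / sqrt 2)"
  "hadamard $ False $ True = complex_of_real (1 / sqrt 2)"
  "hadamard $ False $ False = complex_of_real (1 / sqrt 2)"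
  by (simp_all add: hadamard_def)

lemma hadamard_hadamard: "hadamard ** hadamard = mat 1"
  by (simp only: gate_eq_iff gate_mult_entry hadamard_entries)
    (simp only: mult_minus_left mult_minus_right half, simp add: mat_def)

lemma sigma_hadamard:
  "sigma_x ** hadamard = hadamard ** sigma_z" "sigma_z ** hadamard = hadamard ** sigma_x"
  "sigma_y ** hadamard = hadamard ** (sigma_x ** sigma_y ** sigma_x)"
  by (simp_all add: gate_simps hadamard_entries)

text \<open>Y goes to its negative. Written as XYX, the image is visibly a product of generators of
  \<open>pauli_group\<close>.\<close>

lemma hadamard_conjugation:
  "hadamard ** sigma_x ** hadamard = sigma_z" "hadamard ** sigma_z ** hadamard = sigma_x"
  "hadamard ** sigma_y ** hadamard = sigma_x ** sigma_y ** sigma_x"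
  using sigma_hadamard by (metis hadamard_hadamard matrix_mul_assoc matrix_mul_lid)+

text \<open>Conjugation by the Hadamard gate is an involution, so mapping the Pauli group into
  itself already makes it onto.\<close>

lemma hadamard_in_clifford_group: "hadamard \<in> clifford_group"
proof -
  let ?c = "\<lambda>g. hadamard ** g ** hadamard"
  have cc: "?c (?c g) = g" for g
  proof -
    have "?c (?c g) = (hadamard ** hadamard) ** g ** (hadamard ** hadamard)"
      by (simp only: matrix_mul_assoc)
    then show ?thesis by (simp only: hadamard_hadamard matrix_mul_lid matrix_mul_rid)
  qed
  have in_pauli: "?c g \<in> pauli_group" if "g \<in> pauli_group" for g
    using that
  proof induction
    case (mult g h)
    have "?c g ** ?c h = hadamard ** g ** (hadamard ** hadamard) ** h ** hadamard"
      by (simp only: matrix_mul_assoc)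
    also have "\<dots> = ?c (g ** h)"
      by (simp only: hadamard_hadamard matrix_mul_rid matrix_mul_assoc)
    finally have "?c (g ** h) = ?c g ** ?c h" by simp
    then show ?case using mult by (simp add: pauli_group.mult)
  qed (simp_all add: hadamard_hadamard hadamard_conjugation pauli_group.intros)
  have "?c ` pauli_group = pauli_group"
  proof
    show "?c ` pauli_group \<subseteq> pauli_group" using in_pauli by blast
    show "pauli_group \<subseteq> ?c ` pauli_group"
    proof
      fix g assume "g \<in> pauli_group"
      then show "g \<in> ?c ` pauli_group" by (intro image_eqI[of _ _ "?c g"] in_pauli) (simp only: cc)
    qed
  qed
  then show ?thesis
    by (simp add: clifford_group_def unitary_group_def hadamard_dagger hadamard_hadamard)
qed

lemma one_in_clifford_group: "mat 1 \<in> clifford_group"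
proof -
  have "dagger (mat 1) = mat 1" by (auto simp: gate_simps dagger_def)
  then show ?thesis by (simp add: clifford_group_def unitary_group_def)
qed

section \<open>The obstruction for the triangle-shaped tetriamond\<close>

text \<open>The string applies one fixed Pauli, X or Z, on all of \<open>S\<close>, and the two bit
  functions give its image at each qubit. The condition is the equation "Z part = adjacency matrix
  times X part" over GF(2) for the image string.\<close>

definition binary_stabilizer ::
    "'q set \<Rightarrow> ('q \<Rightarrow> 'q \<Rightarrow> bool) \<Rightarrow> ('q \<Rightarrow> bool) \<Rightarrow> ('q \<Rightarrow> bool) \<Rightarrow> 'q set \<Rightarrow> bool" where
  "binary_stabilizer Q N \<alpha> \<gamma> S \<longleftrightarrow> (\<forall>v\<in>Q. v \<in> S \<and> \<gamma> v \<longleftrightarrow> odd (card (S \<inter> {w. N v w \<and> \<alpha> w})))"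

lemma odd_card_insert_Int:
  assumes "finite S" "x \<notin> S"
  shows "odd (card (insert x S \<inter> C)) \<longleftrightarrow> (x \<in> C) \<noteq> odd (card (S \<inter> C))"
  using assms by (simp add: Int_insert_left)

text \<open>The side of the central triangle opposite to corner \<open>i\<close> is \<open>ci\<close>, and \<open>aij\<close> joins the
  outer corner adjacent to \<open>ci\<close> to the central corner \<open>j\<close>.\<close>

locale tetriamond_graph =
  fixes N :: "'q \<Rightarrow> 'q \<Rightarrow> bool" and \<alpha> \<beta> \<gamma> \<delta> :: "'q \<Rightarrow> bool"
    and c1 c2 c3 a12 a13 a21 a23 a31 a32 :: 'q and Q :: "'q set"
  assumes Q: "Q = {c1, c2, c3, a12, a13, a21, a23, a31, a32}"
    and dist: "distinct [c1, c2, c3, a12, a13, a21, a23, a31, a32]"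
    and sym: "N v w \<longleftrightarrow> N w v" and irr: "\<not> N v v"
    and far: "\<not> N c1 a21" "\<not> N c1 a31" "\<not> N c2 a12" "\<not> N c2 a32" "\<not> N c3 a13" "\<not> N c3 a23"
      "\<not> N a12 a21" "\<not> N a12 a23" "\<not> N a12 a31" "\<not> N a13 a21" "\<not> N a13 a31" "\<not> N a13 a32"
      "\<not> N a21 a32" "\<not> N a23 a31" "\<not> N a23 a32"
    and bits: "v \<in> Q \<Longrightarrow> (\<alpha> v \<and> \<delta> v) \<noteq> (\<beta> v \<and> \<gamma> v)"
    and outer_stars: "binary_stabilizer Q N \<alpha> \<gamma> {a12, a13}" "binary_stabilizer Q N \<alpha> \<gamma> {a21, a23}"
      "binary_stabilizer Q N \<alpha> \<gamma> {a31, a32}"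
    and inner_stars: "binary_stabilizer Q N \<alpha> \<gamma> {c2, c3, a21, a31}"
      "binary_stabilizer Q N \<alpha> \<gamma> {c1, c3, a12, a32}" "binary_stabilizer Q N \<alpha> \<gamma> {c1, c2, a13, a23}"
    and outer_triangles: "binary_stabilizer Q N \<beta> \<delta> {c1, a12, a13}"
      "binary_stabilizer Q N \<beta> \<delta> {c2, a21, a23}" "binary_stabilizer Q N \<beta> \<delta> {c3, a31, a32}"
    and inner_triangle: "binary_stabilizer Q N \<beta> \<delta> {c1, c2, c3}"
begin

text \<open>The assumptions are invariant under permuting the indices 1, 2, 3. With
  \<open>swap23\<close> this yields all permutations, so each fact is proved for one labelling
  only.\<close>

lemma swap12: "tetriamond_graph N \<alpha> \<beta> \<gamma> \<delta> c2 c1 c3 a21 a23 a12 a13 a32 a31 Q"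
  by unfold_locales
    (use Q dist sym irr far bits outer_stars inner_stars outer_triangles inner_triangle in
      \<open>auto simp: insert_commute\<close>)

lemma swap23: "tetriamond_graph N \<alpha> \<beta> \<gamma> \<delta> c1 c3 c2 a13 a12 a31 a32 a21 a23 Q"
  by unfold_locales
    (use Q dist sym irr far bits outer_stars inner_stars outer_triangles inner_triangle in
      \<open>auto simp: insert_commute\<close>)

section \<open>Connections between the three groups of qubits\<close>

definition joined :: "'q set \<Rightarrow> 'q set \<Rightarrow> bool" where
  "joined A B \<longleftrightarrow> (\<exists>v\<in>A. \<exists>w\<in>B. N v w)"

lemma members: "c1 \<in> Q" "c2 \<in> Q" "c3 \<in> Q" "a12 \<in> Q" "a13 \<in> Q" "a21 \<in> Q" "a23 \<in> Q" "a31 \<in> Q" "a32 \<in> Q"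
  by (simp_all add: Q)

lemmas bit_facts = members[THEN bits]

lemma outer_star: "v \<in> Q \<Longrightarrow> (v = a12 \<or> v = a13) \<and> \<gamma> v \<longleftrightarrow> ((N v a12 \<and> \<alpha> a12) \<noteq> (N v a13 \<and> \<alpha> a13))"
  using outer_stars(1) dist by (simp add: binary_stabilizer_def odd_card_insert_Int)

lemma outer_triangle:
  "v \<in> Q \<Longrightarrow> (v = c1 \<or> v = a12 \<or> v = a13) \<and> \<delta> v \<longleftrightarrow>
     ((N v c1 \<and> \<beta> c1) \<noteq> ((N v a12 \<and> \<beta> a12) \<noteq> (N v a13 \<and> \<beta> a13)))"
  using outer_triangles(1) dist by (simp add: binary_stabilizer_def odd_card_insert_Int)

lemma inner_star:
  "v \<in> Q \<Longrightarrow> (v = c1 \<or> v = c2 \<or> v = a13 \<or> v = a23) \<and> \<gamma> v \<longleftrightarrow>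
     ((N v c1 \<and> \<alpha> c1) \<noteq> ((N v c2 \<and> \<alpha> c2) \<noteq> ((N v a13 \<and> \<alpha> a13) \<noteq> (N v a23 \<and> \<alpha> a23))))"
  using inner_stars(3) dist by (simp add: binary_stabilizer_def odd_card_insert_Int)

lemma inner_triangle_eq:
  "v \<in> Q \<Longrightarrow> (v = c1 \<or> v = c2 \<or> v = c3) \<and> \<delta> v \<longleftrightarrow>
     ((N v c1 \<and> \<beta> c1) \<noteq> ((N v c2 \<and> \<beta> c2) \<noteq> (N v c3 \<and> \<beta> c3)))"
  using inner_triangle dist by (simp add: binary_stabilizer_def odd_card_insert_Int)

text \<open>The rank bound: the outer star and the outer plaquette each impose a linear equation
  over GF(2) on the row of an outside vertex. The equations are independent, so at most one nonzero
  row of length three solves both.\<close>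

lemma row_nonzero_unique:
  assumes v: "v \<in> Q" "v \<notin> {c1, a12, a13}" "N v c1 \<or> N v a12 \<or> N v a13"
    and w: "w \<in> Q" "w \<notin> {c1, a12, a13}" "N w c1 \<or> N w a12 \<or> N w a13"
  shows "N v c1 = N w c1 \<and> N v a12 = N w a12 \<and> N v a13 = N w a13"
proof -
  note ineq = dist[simplified]
  have i: "N a12 c1 = N c1 a12" "N a13 c1 = N c1 a13" "N a13 a12 = N a12 a13"
    by (rule sym)+
  have s: "(N v a12 \<and> \<alpha> a12) = (N v a13 \<and> \<alpha> a13)" "(N w a12 \<and> \<alpha> a12) = (N w a13 \<and> \<alpha> a13)"
    "\<gamma> a12 = (N a12 a13 \<and> \<alpha> a13)" "\<gamma> a13 = (N a12 a13 \<and> \<alpha> a12)"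
    "(N c1 a12 \<and> \<alpha> a12) = (N c1 a13 \<and> \<alpha> a13)"
    using outer_star[OF v(1)] outer_star[OF w(1)] v w outer_star[OF members(1)]
      outer_star[OF members(4)] outer_star[OF members(5)] ineq by (auto simp: irr i)
  have t: "(N v c1 \<and> \<beta> c1) = ((N v a12 \<and> \<beta> a12) \<noteq> (N v a13 \<and> \<beta> a13))"
    "(N w c1 \<and> \<beta> c1) = ((N w a12 \<and> \<beta> a12) \<noteq> (N w a13 \<and> \<beta> a13))"
    "\<delta> c1 = ((N c1 a12 \<and> \<beta> a12) \<noteq> (N c1 a13 \<and> \<beta> a13))"
    "\<delta> a12 = ((N c1 a12 \<and> \<beta> c1) \<noteq> (N a12 a13 \<and> \<beta> a13))"
    "\<delta> a13 = ((N c1 a13 \<and> \<beta> c1) \<noteq> (N a12 a13 \<and> \<beta> a12))"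
    using outer_triangle[OF v(1)] outer_triangle[OF w(1)] v w outer_triangle[OF members(1)]
      outer_triangle[OF members(4)] outer_triangle[OF members(5)] by (simp_all add: irr i)
  \<comment> \<open>Were the equations dependent, the star, the plaquette or their product would
    have an empty X part, hence an empty Z part. At \<open>a12\<close> and \<open>a13\<close> for
    the star, or at \<open>c1\<close> otherwise, both relevant bits would vanish, against
    \<open>bits\<close>.\<close>
  show ?thesis
    using s t v(3) w(3) bit_facts(1) bit_facts(4,5) by argo
qed

text \<open>By locality the second group never meets \<open>a12\<close> and the third never meets
  \<open>a13\<close>. Both see the same nonzero row, which therefore has its only entry at
  \<open>c1\<close>; the outer plaquette then forces \<open>\<beta> c1\<close> to vanish.\<close>

lemma joined_both:
  assumes "joined {c2, a21, a23} {c1, a12, a13}" "joined {c3, a31, a32} {c1, a12, a13}"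
  shows "\<not> \<beta> c1" "\<And>v. v \<in> {c2, a21, a23, c3, a31, a32} \<Longrightarrow> \<not> N v a12 \<and> \<not> N v a13"
proof -
  note ineq = dist[simplified]
  obtain v where v: "v \<in> {c2, a21, a23}" "N v c1 \<or> N v a12 \<or> N v a13"
    using assms(1) unfolding joined_def by blast
  obtain w where w: "w \<in> {c3, a31, a32}" "N w c1 \<or> N w a12 \<or> N w a13"
    using assms(2) unfolding joined_def by blast
  have Qv: "v \<in> Q" "v \<notin> {c1, a12, a13}" and Qw: "w \<in> Q" "w \<notin> {c1, a12, a13}"
    using v(1) w(1) ineq by (auto simp: Q)
  have "\<not> N v a12" "\<not> N w a13"
    using v(1) w(1) far sym by auto
  then have v': "N v c1" "\<not> N v a12" "\<not> N v a13"
    using row_nonzero_unique[OF Qv v(2) Qw w(2)] v(2) by auto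
  then show "\<not> \<beta> c1" using outer_triangle[OF Qv(1)] Qv(2) by auto
  show "\<not> N x a12 \<and> \<not> N x a13" if "x \<in> {c2, a21, a23, c3, a31, a32}" for x
  proof -
    have "x \<in> Q" "x \<notin> {c1, a12, a13}" using that ineq by (auto simp: Q)
    then show ?thesis using row_nonzero_unique[OF Qv v(2), of x] v' by blast
  qed
qed

text \<open>Without outside contacts the central plaquette gives \<open>\<not> \<delta> c1\<close>,
  hence \<open>\<beta> c1\<close> and \<open>\<gamma> c1\<close>, and it also excludes an edge from
  \<open>c1\<close> to \<open>a13\<close>. But the star at corner 3 needs that edge to produce
  \<open>\<gamma> c1\<close>.\<close>

lemma not_isolated: "joined {c2, a21, a23} {c1, a12, a13} \<or> joined {c3, a31, a32} {c1, a12, a13}"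
proof (rule ccontr)
  assume "\<not> ?thesis"
  then have iso: "\<not> N c1 x" "\<not> N a12 x" "\<not> N a13 x" if "x \<in> {c2, c3, a21, a23, a31, a32}" for x
    using that sym unfolding joined_def by blast+
  note ineq = dist[simplified]
  have "\<delta> c1 = False" "\<not> (N a12 c1 \<and> \<beta> c1)" "\<not> (N a13 c1 \<and> \<beta> c1)"
    using inner_triangle_eq[OF members(1)] inner_triangle_eq[OF members(4)]
      inner_triangle_eq[OF members(5)] ineq by (auto simp: irr iso)
  moreover have "\<gamma> c1 = (N c1 a13 \<and> \<alpha> a13)"
    using inner_star[OF members(1)] by (simp add: irr iso)
  ultimately show False using bit_facts(1) sym by blast
qed

text \<open>The star at corner 3 is used to show that the third group has no contact with
  \<open>c1\<close>, its only possible contact in the first group.\<close>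

lemma half_joined_contradiction:
  assumes J: "joined {c2, a21, a23} {c1, a12, a13}" "joined {c3, a31, a32} {c1, a12, a13}"
    and nJ: "\<not> joined {c2, a21, a23} {c3, a31, a32}" and c2: "\<beta> c2" "N c1 c2"
  shows False
proof -
  note ineq = dist[simplified]
  have b1: "\<not> \<beta> c1" and no: "\<And>x. x \<in> {c2, a21, a23, c3, a31, a32} \<Longrightarrow> \<not> N x a12 \<and> \<not> N x a13"
    using joined_both[OF J] by blast+
  have iso: "\<not> N x y" "\<not> N y x" if "x \<in> {c2, a21, a23}" "y \<in> {c3, a31, a32}" for x y
    using nJ that sym unfolding joined_def by blast+
  \<comment> \<open>In the central plaquette at the qubits of the second group, \<open>c1\<close>
    drops out because \<open>\<not> \<beta> c1\<close>, and \<open>c3\<close> because the groups are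
    not joined; only the term of \<open>c2\<close> remains.\<close>
  have inner: "\<not> N a21 c2" "\<not> N a23 c2" "\<not> \<delta> c2"
    using inner_triangle_eq[OF members(6)] inner_triangle_eq[OF members(7)]
      inner_triangle_eq[OF members(2)] c2 b1 iso ineq by (auto simp: irr)
  interpret S: tetriamond_graph N \<alpha> \<beta> \<gamma> \<delta> c2 c1 c3 a21 a23 a12 a13 a32 a31 Q by (rule swap12)
  \<comment> \<open>Since \<open>c1\<close> and \<open>a21\<close> are not adjacent, the second
    outer plaquette at \<open>c1\<close> needs \<open>a23\<close> to cancel the term of
    \<open>c2\<close>, and the second outer star then needs \<open>\<alpha> a23\<close> to
    vanish.\<close>
  have a: "N c1 a23" "\<not> \<alpha> a23"
    using S.outer_triangle[OF members(1)] S.outer_star[OF members(1)] c2 far ineq by auto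
  have "\<gamma> c2" "\<alpha> c1" using bits[OF members(2)] inner(3) bits[OF members(1)] b1 by auto
  \<comment> \<open>At \<open>x\<close> every term of the star at corner 3 except that of
    \<open>c1\<close> vanishes, and \<open>\<alpha> c1\<close> holds.\<close>
  have "\<not> N x c1 \<and> \<not> N x a12 \<and> \<not> N x a13" if "x \<in> {c3, a31, a32}" for x
    using inner_star[of x] that iso no[of x] a(2) \<open>\<alpha> c1\<close> ineq by (auto simp: Q)
  then show False using J(2) unfolding joined_def by blast
qed

text \<open>From \<open>\<not> \<beta> c1\<close> follows \<open>\<delta> c1\<close>, so the central
  plaquette at \<open>c1\<close> has an odd number of contributions from \<open>c2\<close> and
  \<open>c3\<close>. The two cases are exchanged by \<open>swap23\<close>.\<close>

lemma chain_contradiction: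
  assumes J: "joined {c2, a21, a23} {c1, a12, a13}" "joined {c3, a31, a32} {c1, a12, a13}"
    and nJ: "\<not> joined {c2, a21, a23} {c3, a31, a32}"
  shows False
proof -
  interpret S: tetriamond_graph N \<alpha> \<beta> \<gamma> \<delta> c1 c3 c2 a13 a12 a31 a32 a21 a23 Q by (rule swap23)
  have "\<delta> c1" using joined_both(1)[OF J] bits[OF members(1)] by auto
  then have "\<beta> c2 \<and> N c1 c2 \<or> \<beta> c3 \<and> N c1 c3"
    using inner_triangle_eq[OF members(1)] by (auto simp: irr)
  moreover have "S.joined {c3, a32, a31} {c1, a13, a12}" "S.joined {c2, a21, a23} {c1, a13, a12}"
    "\<not> S.joined {c3, a32, a31} {c2, a23, a21}"
    using assms sym unfolding joined_def S.joined_def by blast+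
  ultimately show False
    using half_joined_contradiction[OF assms] S.half_joined_contradiction
    by (auto simp: insert_commute)
qed

text \<open>No group is isolated and no two are joined only through the third, so all pairs are
  joined. Then the bits \<open>\<beta>\<close> vanish at all three central sides and the central
  plaquette becomes a pure Z string.\<close>

lemma contradiction: False
proof -
  let ?S1 = "{c1, a12, a13}" and ?S2 = "{c2, a21, a23}" and ?S3 = "{c3, a31, a32}"
  interpret S12: tetriamond_graph N \<alpha> \<beta> \<gamma> \<delta> c2 c1 c3 a21 a23 a12 a13 a32 a31 Q by (rule swap12)
  \<comment> \<open>The cyclic relabelling that puts the third group in the place of the
    first.\<close>
  interpret S13: tetriamond_graph N \<alpha> \<beta> \<gamma> \<delta> c3 c1 c2 a31 a32 a13 a12 a23 a21 Q
    by (rule tetriamond_graph.swap12[OF swap23])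
  have jsym: "joined A B \<longleftrightarrow> joined B A" for A B using sym unfolding joined_def by blast
  have iso: "joined ?S2 ?S1 \<or> joined ?S3 ?S1" "joined ?S1 ?S2 \<or> joined ?S3 ?S2"
    "joined ?S1 ?S3 \<or> joined ?S2 ?S3"
    using not_isolated S12.not_isolated S13.not_isolated by (simp_all add: insert_commute)
  have chain: "joined ?S2 ?S1 \<Longrightarrow> joined ?S3 ?S1 \<Longrightarrow> joined ?S2 ?S3"
    "joined ?S1 ?S2 \<Longrightarrow> joined ?S3 ?S2 \<Longrightarrow> joined ?S1 ?S3"
    "joined ?S1 ?S3 \<Longrightarrow> joined ?S2 ?S3 \<Longrightarrow> joined ?S1 ?S2"
    using chain_contradiction S12.chain_contradiction S13.chain_contradiction
    by (auto simp: insert_commute)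
  have J: "joined ?S2 ?S1" "joined ?S3 ?S1" "joined ?S3 ?S2"
    using iso chain jsym by blast+
  then have "\<not> \<beta> c1" "\<not> \<beta> c2" "\<not> \<beta> c3"
    using joined_both(1) S12.joined_both(1) S13.joined_both(1) jsym
    by (simp_all add: insert_commute)
  then show False
    using inner_triangle_eq[OF members(1)] bits[OF members(1)] by simp
qed

end

section \<open>Local Clifford equivalence with a graph state\<close>

text \<open>Pushing the gates \<open>U i\<close> through a stabilizer of \<open>\<psi>\<close> costs
  one scalar per qubit. The scalars are only known to be nonzero, which is why
  \<open>common_eigenstate_commute\<close> admits an arbitrary nonzero eigenvalue.\<close>

lemma transport_stabilizer:
  assumes fin: "finite Q" and \<phi>: "\<phi> = tensor_apply Q U \<psi>" and g: "tensor_apply Q g \<psi> = \<psi>"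
    and Ug: "\<And>i. i \<in> Q \<Longrightarrow> U i ** g i = mat (k i) ** (x_on A i ** z_on B i) ** U i"
    and k: "\<And>i. i \<in> Q \<Longrightarrow> k i \<noteq> 0"
  shows "tensor_apply Q (\<lambda>i. x_on A i ** z_on B i) \<phi> = (\<lambda>S. inverse (\<Prod>i\<in>Q. k i) * \<phi> S)"
proof -
  let ?P = "\<lambda>i. x_on A i ** z_on B i"
  have "\<phi> = tensor_apply Q (\<lambda>i. U i ** g i) \<psi>"
    by (simp add: \<phi> g flip: tensor_apply_compose[OF fin])
  also have "\<dots> = tensor_apply Q (\<lambda>i. mat (k i) ** (?P i ** U i)) \<psi>"
    by (rule tensor_apply_cong) (simp add: Ug matrix_mul_assoc)
  also have "\<dots> = (\<lambda>S. (\<Prod>i\<in>Q. k i) * tensor_apply Q ?P \<phi> S)"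
    by (simp add: tensor_apply_scaled \<phi> tensor_apply_compose[OF fin])
  finally have eq: "\<phi> S = (\<Prod>i\<in>Q. k i) * tensor_apply Q ?P \<phi> S" for S by (rule fun_cong)
  have "(\<Prod>i\<in>Q. k i) \<noteq> 0" using fin k by simp
  then show ?thesis using eq by (simp add: fun_eq_iff field_simps)
qed

text \<open>Passage from states to GF(2): after this only the symplectic bits of the local gates and
  the adjacency relation matter.\<close>

lemma LC_equivalent_graph_state_bits:
  assumes fin: "finite Q" and E: "simple_graph Q E" and \<phi>: "graph_state Q E \<phi>"
    and LC: "LC_equivalent Q \<psi> \<phi>"
  obtains \<alpha> \<beta> \<gamma> \<delta> where "\<And>i. i \<in> Q \<Longrightarrow> (\<alpha> i \<and> \<delta> i) \<noteq> (\<beta> i \<and> \<gamma> i)"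
    "\<And>S. S \<subseteq> Q \<Longrightarrow> tensor_apply Q (x_on S) \<psi> = \<psi> \<Longrightarrow>
       binary_stabilizer Q (\<lambda>v w. (v, w) \<in> E) \<alpha> \<gamma> S"
    "\<And>S. S \<subseteq> Q \<Longrightarrow> tensor_apply Q (z_on S) \<psi> = \<psi> \<Longrightarrow>
       binary_stabilizer Q (\<lambda>v w. (v, w) \<in> E) \<beta> \<delta> S"
proof -
  obtain U where U: "\<And>i. i \<in> Q \<Longrightarrow> U i \<in> clifford_group" and \<phi>U: "\<phi> = tensor_apply Q U \<psi>"
    using LC by (auto simp: LC_equivalent_def)
  have "\<forall>i\<in>Q. \<exists>\<alpha> \<beta> \<gamma> \<delta> \<omega> \<omega>'. \<omega> \<noteq> 0 \<and> U i ** sigma_x = mat \<omega> ** pauli \<alpha> \<gamma> ** U i \<and>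
      \<omega>' \<noteq> 0 \<and> U i ** sigma_z = mat \<omega>' ** pauli \<beta> \<delta> ** U i \<and> (\<alpha> \<and> \<delta>) \<noteq> (\<beta> \<and> \<gamma>)"
  proof
    fix i assume "i \<in> Q"
    then show "\<exists>\<alpha> \<beta> \<gamma> \<delta> \<omega> \<omega>'. \<omega> \<noteq> 0 \<and> U i ** sigma_x = mat \<omega> ** pauli \<alpha> \<gamma> ** U i \<and>
        \<omega>' \<noteq> 0 \<and> U i ** sigma_z = mat \<omega>' ** pauli \<beta> \<delta> ** U i \<and> (\<alpha> \<and> \<delta>) \<noteq> (\<beta> \<and> \<gamma>)"
      by (rule clifford_symplectic[OF U]) (intro exI conjI)
  qed
  then obtain \<alpha> \<beta> \<gamma> \<delta> \<omega> \<omega>' where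
      x: "\<And>i. i \<in> Q \<Longrightarrow> \<omega> i \<noteq> 0 \<and> U i ** sigma_x = mat (\<omega> i) ** pauli (\<alpha> i) (\<gamma> i) ** U i"
    and z: "\<And>i. i \<in> Q \<Longrightarrow> \<omega>' i \<noteq> 0 \<and> U i ** sigma_z = mat (\<omega>' i) ** pauli (\<beta> i) (\<delta> i) ** U i"
    and bits: "\<And>i. i \<in> Q \<Longrightarrow> (\<alpha> i \<and> \<delta> i) \<noteq> (\<beta> i \<and> \<gamma> i)"
    unfolding bchoice_iff by blast
  \<comment> \<open>One argument for both kinds of strings: \<open>s\<close> is X or Z, and
    \<open>a\<close>, \<open>b\<close> are the bits of its image.\<close>
  have main: "binary_stabilizer Q (\<lambda>v w. (v, w) \<in> E) a b S"
    if S: "S \<subseteq> Q" and g: "tensor_apply Q (\<lambda>i. if i \<in> S then s else mat 1) \<psi> = \<psi>"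
      and s: "\<And>i. i \<in> Q \<Longrightarrow> k i \<noteq> 0 \<and> U i ** s = mat (k i) ** pauli (a i) (b i) ** U i"
    for S a b s k
  proof -
    let ?A = "{i \<in> S. a i}" and ?B = "{i \<in> S. b i}"
    let ?k = "\<lambda>i. if i \<in> S then k i else 1"
    have "tensor_apply Q (\<lambda>i. x_on ?A i ** z_on ?B i) \<phi> = (\<lambda>T. inverse (\<Prod>i\<in>Q. ?k i) * \<phi> T)"
    proof (rule transport_stabilizer[OF fin \<phi>U g])
      fix i assume i: "i \<in> Q"
      show "?k i \<noteq> 0" using s[OF i] by simp
      show "U i ** (if i \<in> S then s else mat 1) = mat (?k i) ** (x_on ?A i ** z_on ?B i) ** U i"
      proof (cases "i \<in> S")
        case True
        then show ?thesis using s[OF i] pauli_on[of i ?A ?B] by simp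
      next
        case False
        then show ?thesis by (simp add: x_on_def z_on_def)
      qed
    qed
    moreover have "inverse (\<Prod>i\<in>Q. ?k i) \<noteq> 0" using fin s by simp
    ultimately have "v \<in> ?B \<longleftrightarrow> odd (card (E `` {v} \<inter> ?A))" if "v \<in> Q" for v
      using graph_state_stabilizer[OF fin E \<phi>, of ?A ?B] S that by blast
    moreover have "E `` {v} \<inter> ?A = S \<inter> {w. (v, w) \<in> E \<and> a w}" for v by auto
    ultimately show ?thesis by (simp add: binary_stabilizer_def)
  qed
  show ?thesis
  proof (rule that[OF bits])
    show "binary_stabilizer Q (\<lambda>v w. (v, w) \<in> E) \<alpha> \<gamma> S"
      if "S \<subseteq> Q" "tensor_apply Q (x_on S) \<psi> = \<psi>" for S
      using that(2) unfolding x_on_def[abs_def] by (rule main[OF that(1) _ x])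
    show "binary_stabilizer Q (\<lambda>v w. (v, w) \<in> E) \<beta> \<delta> S"
      if "S \<subseteq> Q" "tensor_apply Q (z_on S) \<psi> = \<psi>" for S
      using that(2) unfolding z_on_def[abs_def] by (rule main[OF that(1) _ z])
  qed
qed

section \<open>The triangle-shaped tetriamond\<close>

lemma sides_triangle:
  assumes "distinct [a, b, c]"
  shows "sides {a, b, c} = {{a, b}, {a, c}, {b, c}}"
proof
  show "{{a, b}, {a, c}, {b, c}} \<subseteq> sides {a, b, c}" using assms by (auto simp: sides_def)
  show "sides {a, b, c} \<subseteq> {{a, b}, {a, c}, {b, c}}"
  proof
    fix e assume "e \<in> sides {a, b, c}"
    then obtain x y where "e = {x, y}" "x \<noteq> y" "x \<in> {a, b, c}" "y \<in> {a, b, c}"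
      by (auto simp: sides_def card_2_iff)
    then show "e \<in> {{a, b}, {a, c}, {b, c}}" by (auto simp: insert_commute)
  qed
qed

text \<open>The ground state is defined through cycles, so plaquette stabilizers are obtained by
  viewing a triangle as a cycle of length three.\<close>

lemma triangle_cycle:
  assumes "distinct [a, b, c]" "{{a, b}, {a, c}, {b, c}} \<subseteq> qubits P"
  shows "{{a, b}, {a, c}, {b, c}} \<in> cycles P"
proof -
  have lt3: "{f k | k. k < 3} = {f 0, f 1, f 2}" for f :: "nat \<Rightarrow> point set"
  proof -
    have "{f k | k. k < 3} = f ` {..<Suc (Suc (Suc 0))}" by auto
    then show ?thesis by (simp add: lessThan_Suc insert_commute numeral_2_eq_2)
  qed
  have len: "length [a, b, c] = 3" by simp
  have "cycle_edges [a, b, c] = {{a, b}, {b, c}, {c, a}}"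
    unfolding cycle_edges_def len lt3 by simp
  then have eq: "cycle_edges [a, b, c] = {{a, b}, {a, c}, {b, c}}" by (simp add: insert_commute)
  show ?thesis
    unfolding cycles_def mem_Collect_eq
    by (rule exI[of _ "[a, b, c]"]) (use assms in \<open>simp add: eq\<close>)
qed

lemma qubits_tetriamond:
  assumes "distinct [u1, u2, u3, o1, o2, o3]"
  shows "qubits {{u1, u2, u3}, {o1, u2, u3}, {o2, u1, u3}, {o3, u1, u2}} =
    {{u2, u3}, {u1, u3}, {u1, u2}, {o1, u2}, {o1, u3}, {o2, u1}, {o2, u3}, {o3, u1}, {o3, u2}}"
proof -
  have tri: "distinct [u1, u2, u3]" "distinct [o1, u2, u3]" "distinct [o2, u1, u3]" "distinct [o3, u1, u2]"
    using assms by auto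
  show ?thesis
    unfolding qubits_def UN_insert UN_empty sides_triangle[OF tri(1)] sides_triangle[OF tri(2)]
      sides_triangle[OF tri(3)] sides_triangle[OF tri(4)]
    by (simp add: insert_commute)
qed

lemma tetriamond_not_local:
  assumes dist: "distinct [u1, u2, u3, o1, o2, o3]"
    and P: "P = {{u1, u2, u3}, {o1, u2, u3}, {o2, u1, u3}, {o3, u1, u2}}"
    and \<psi>: "toric_ground_state P \<psi>" and E: "simple_graph (qubits P) E"
    and \<phi>: "graph_state (qubits P) E \<phi>" and LC: "LC_equivalent (qubits P) \<psi> \<phi>"
  shows "\<not> local_graph P E"
proof (rule notI)
  assume local: "local_graph P E"
  \<comment> \<open>The reversed list supplies every inequality in its other orientation for the
    simplifier.\<close>
  have "distinct [o3, o2, o1, u3, u2, u1]" using dist by auto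
  note ineq = dist[simplified] this[simplified]
  let ?c1 = "{u2, u3}" and ?c2 = "{u1, u3}" and ?c3 = "{u1, u2}"
  let ?a12 = "{o1, u2}" and ?a13 = "{o1, u3}" and ?a21 = "{o2, u1}" and ?a23 = "{o2, u3}"
    and ?a31 = "{o3, u1}" and ?a32 = "{o3, u2}"
  have tri: "distinct [u1, u2, u3]" "distinct [o1, u2, u3]" "distinct [o2, u1, u3]" "distinct [o3, u1, u2]"
    using ineq by auto
  have Q: "qubits P = {?c1, ?c2, ?c3, ?a12, ?a13, ?a21, ?a23, ?a31, ?a32}"
    unfolding P by (rule qubits_tetriamond[OF dist])
  then have fin: "finite (qubits P)" by simp
  obtain \<alpha> \<beta> \<gamma> \<delta> where bits: "\<And>i. i \<in> qubits P \<Longrightarrow> (\<alpha> i \<and> \<delta> i) \<noteq> (\<beta> i \<and> \<gamma> i)"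
    and X: "\<And>S. S \<subseteq> qubits P \<Longrightarrow> tensor_apply (qubits P) (x_on S) \<psi> = \<psi> \<Longrightarrow>
       binary_stabilizer (qubits P) (\<lambda>v w. (v, w) \<in> E) \<alpha> \<gamma> S"
    and Z: "\<And>S. S \<subseteq> qubits P \<Longrightarrow> tensor_apply (qubits P) (z_on S) \<psi> = \<psi> \<Longrightarrow>
       binary_stabilizer (qubits P) (\<lambda>v w. (v, w) \<in> E) \<beta> \<delta> S"
    by (rule LC_equivalent_graph_state_bits[OF fin E \<phi> LC]) blast
  have star: "binary_stabilizer (qubits P) (\<lambda>v w. (v, w) \<in> E) \<alpha> \<gamma> (star P s)" if "s \<in> corners P" for s
    using \<psi> that by (intro X) (auto simp: star_def toric_ground_state_def)
  have star_eq: "star P s = {e \<in> {?c1, ?c2, ?c3, ?a12, ?a13, ?a21, ?a23, ?a31, ?a32}. s \<in> e}" for s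
    by (simp add: star_def Q)
  have corners: "corners P = {u1, u2, u3, o1, o2, o3}" by (auto simp: corners_def P)
  have filter_insert: "{e \<in> insert x S. s \<in> e} = (if s \<in> x then insert x {e \<in> S. s \<in> e} else {e \<in> S. s \<in> e})"
    for x S and s :: point by auto
  have triangle: "binary_stabilizer (qubits P) (\<lambda>v w. (v, w) \<in> E) \<beta> \<delta> {{a, b}, {a, c}, {b, c}}"
    if "distinct [a, b, c]" "{{a, b}, {a, c}, {b, c}} \<subseteq> qubits P" for a b c
    using \<psi> triangle_cycle[OF that] that by (intro Z) (auto simp: toric_ground_state_def)
  \<comment> \<open>Two sides of one triangle also meet in a corner, so vicinal edges always share
    an endpoint.\<close>
  have disjoint: "(e, f) \<notin> E" if "e \<inter> f = {}" for e f
  proof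
    assume "(e, f) \<in> E"
    then have "vicinal P e f" using local by (auto simp: local_graph_def)
    then consider s where "s \<in> e" "s \<in> f" | p where "p \<in> P" "e \<in> sides p" "f \<in> sides p"
      by (auto simp: vicinal_def star_def)
    then show False
    proof cases
      case 2
      then obtain a b c where "p = {a, b, c}" "distinct [a, b, c]"
        using tri unfolding P by blast
      then have "e \<inter> f \<noteq> {}" using 2(2,3) by (auto simp: sides_triangle)
      then show False using that by blast
    qed (use that in blast)
  qed
  have E': "(v, w) \<in> E \<longleftrightarrow> (w, v) \<in> E" "(v, v) \<notin> E" for v w
    using E by (auto simp: simple_graph_def sym_def irrefl_def)
  have far: "(?c1, ?a21) \<notin> E" "(?c1, ?a31) \<notin> E" "(?c2, ?a12) \<notin> E" "(?c2, ?a32) \<notin> E"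
    "(?c3, ?a13) \<notin> E" "(?c3, ?a23) \<notin> E" "(?a12, ?a21) \<notin> E" "(?a12, ?a23) \<notin> E"
    "(?a12, ?a31) \<notin> E" "(?a13, ?a21) \<notin> E" "(?a13, ?a31) \<notin> E" "(?a13, ?a32) \<notin> E"
    "(?a21, ?a32) \<notin> E" "(?a23, ?a31) \<notin> E" "(?a23, ?a32) \<notin> E"
    by (rule disjoint, use ineq in simp)+
  have stars: "star P o1 = {?a12, ?a13}" "star P o2 = {?a21, ?a23}" "star P o3 = {?a31, ?a32}"
    "star P u1 = {?c2, ?c3, ?a21, ?a31}" "star P u2 = {?c1, ?c3, ?a12, ?a32}"
    "star P u3 = {?c1, ?c2, ?a13, ?a23}"
    unfolding star_eq filter_insert using ineq by simp_all
  have star_gens: "binary_stabilizer (qubits P) (\<lambda>v w. (v, w) \<in> E) \<alpha> \<gamma> {?a12, ?a13}"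
    "binary_stabilizer (qubits P) (\<lambda>v w. (v, w) \<in> E) \<alpha> \<gamma> {?a21, ?a23}"
    "binary_stabilizer (qubits P) (\<lambda>v w. (v, w) \<in> E) \<alpha> \<gamma> {?a31, ?a32}"
    "binary_stabilizer (qubits P) (\<lambda>v w. (v, w) \<in> E) \<alpha> \<gamma> {?c2, ?c3, ?a21, ?a31}"
    "binary_stabilizer (qubits P) (\<lambda>v w. (v, w) \<in> E) \<alpha> \<gamma> {?c1, ?c3, ?a12, ?a32}"
    "binary_stabilizer (qubits P) (\<lambda>v w. (v, w) \<in> E) \<alpha> \<gamma> {?c1, ?c2, ?a13, ?a23}"
    unfolding stars[symmetric] by (rule star, simp add: corners)+
  have triangles: "binary_stabilizer (qubits P) (\<lambda>v w. (v, w) \<in> E) \<beta> \<delta> {?c3, ?c2, ?c1}"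
    "binary_stabilizer (qubits P) (\<lambda>v w. (v, w) \<in> E) \<beta> \<delta> {?a12, ?a13, ?c1}"
    "binary_stabilizer (qubits P) (\<lambda>v w. (v, w) \<in> E) \<beta> \<delta> {?a21, ?a23, ?c2}"
    "binary_stabilizer (qubits P) (\<lambda>v w. (v, w) \<in> E) \<beta> \<delta> {?a31, ?a32, ?c3}"
    by (rule triangle[OF tri(1)] triangle[OF tri(2)] triangle[OF tri(3)] triangle[OF tri(4)],
        simp add: Q)+
  \<comment> \<open>Restricting the type to sets of edges keeps the rewriting from permuting the
    endpoints inside an edge.\<close>
  have rotate: "{x, y, z} = {z, y, x}" "{x, y, z} = {z, x, y}" for x y z :: "point set" by auto
  have "tetriamond_graph (\<lambda>v w. (v, w) \<in> E) \<alpha> \<beta> \<gamma> \<delta> ?c1 ?c2 ?c3 ?a12 ?a13 ?a21 ?a23 ?a31 ?a32 (qubits P)"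
  proof (rule tetriamond_graph.intro)
    show "distinct [?c1, ?c2, ?c3, ?a12, ?a13, ?a21, ?a23, ?a31, ?a32]"
      using ineq by (simp add: doubleton_eq_iff)
    show "binary_stabilizer (qubits P) (\<lambda>v w. (v, w) \<in> E) \<beta> \<delta> {?c1, ?c2, ?c3}"
      using triangles(1) by (subst rotate(1))
    show "binary_stabilizer (qubits P) (\<lambda>v w. (v, w) \<in> E) \<beta> \<delta> {?c1, ?a12, ?a13}"
      using triangles(2) by (simp only: rotate(2)[of ?a12])
    show "binary_stabilizer (qubits P) (\<lambda>v w. (v, w) \<in> E) \<beta> \<delta> {?c2, ?a21, ?a23}"
      using triangles(3) by (simp only: rotate(2)[of ?a21])
    show "binary_stabilizer (qubits P) (\<lambda>v w. (v, w) \<in> E) \<beta> \<delta> {?c3, ?a31, ?a32}"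
      using triangles(4) by (simp only: rotate(2)[of ?a31])
  qed (fact Q far E' bits star_gens)+
  then show False by (rule tetriamond_graph.contradiction)
qed

section \<open>Geometry of the triangular lattice\<close>

definition up_triangle :: "int \<Rightarrow> int \<Rightarrow> point set" where
  "up_triangle i j = {(i, j), (i + 1, j), (i, j + 1)}"

definition down_triangle :: "int \<Rightarrow> int \<Rightarrow> point set" where
  "down_triangle i j = {(i + 1, j), (i, j + 1), (i + 1, j + 1)}"

lemmas triangle_defs = up_triangle_def down_triangle_def

lemma lattice_triangles_eq:
  "lattice_triangles = {up_triangle i j | i j. True} \<union> {down_triangle i j | i j. True}"
  by (simp add: lattice_triangles_def triangle_defs)

lemma lattice_triangle_cases:
  assumes "t \<in> lattice_triangles"
  obtains i j where "t = up_triangle i j" | i j where "t = down_triangle i j"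
  using assms by (auto simp: lattice_triangles_eq)

text \<open>A common side is a pair of distinct common corners, which turns adjacency into
  arithmetic on coordinates.\<close>

lemma sides_meet_iff:
  "sides t \<inter> sides u \<noteq> {} \<longleftrightarrow> (\<exists>a\<in>t. \<exists>b\<in>t. a \<noteq> b \<and> a \<in> u \<and> b \<in> u)"
proof
  assume "sides t \<inter> sides u \<noteq> {}"
  then obtain e where "e \<subseteq> t" "e \<subseteq> u" "card e = 2" unfolding sides_def by blast
  then show "\<exists>a\<in>t. \<exists>b\<in>t. a \<noteq> b \<and> a \<in> u \<and> b \<in> u" unfolding card_2_iff by blast
next
  assume "\<exists>a\<in>t. \<exists>b\<in>t. a \<noteq> b \<and> a \<in> u \<and> b \<in> u"
  then obtain a b where "a \<noteq> b" "a \<in> t" "b \<in> t" "a \<in> u" "b \<in> u" by blast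
  then have "{a, b} \<in> sides t \<inter> sides u" by (simp add: sides_def)
  then show "sides t \<inter> sides u \<noteq> {}" by blast
qed

lemma up_up_sides_meet: "sides (up_triangle i j) \<inter> sides (up_triangle k l) \<noteq> {} \<longleftrightarrow> i = k \<and> j = l"
proof
  assume "sides (up_triangle i j) \<inter> sides (up_triangle k l) \<noteq> {}"
  then obtain a b where "a \<noteq> b" "a \<in> up_triangle i j" "b \<in> up_triangle i j"
    "a \<in> up_triangle k l" "b \<in> up_triangle k l" unfolding sides_meet_iff by blast
  then show "i = k \<and> j = l" unfolding up_triangle_def by (elim insertE emptyE) simp_all
next
  assume "i = k \<and> j = l"
  then have "{(i, j), (i + 1, j)} \<in> sides (up_triangle i j) \<inter> sides (up_triangle k l)"
    by (simp add: sides_def up_triangle_def)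
  then show "sides (up_triangle i j) \<inter> sides (up_triangle k l) \<noteq> {}" by blast
qed

lemma down_down_sides_meet:
  "sides (down_triangle i j) \<inter> sides (down_triangle k l) \<noteq> {} \<longleftrightarrow> i = k \<and> j = l"
proof
  assume "sides (down_triangle i j) \<inter> sides (down_triangle k l) \<noteq> {}"
  then obtain a b where "a \<noteq> b" "a \<in> down_triangle i j" "b \<in> down_triangle i j"
    "a \<in> down_triangle k l" "b \<in> down_triangle k l" unfolding sides_meet_iff by blast
  then show "i = k \<and> j = l" unfolding down_triangle_def by (elim insertE emptyE) simp_all
next
  assume "i = k \<and> j = l"
  then have "{(i + 1, j), (i, j + 1)} \<in> sides (down_triangle i j) \<inter> sides (down_triangle k l)"
    by (simp add: sides_def down_triangle_def)
  then show "sides (down_triangle i j) \<inter> sides (down_triangle k l) \<noteq> {}" by blast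
qed

text \<open>One disjunct for each side of the up triangle. Triangles of equal orientation share no
  side unless they coincide, so the dual graph is the honeycomb, bipartite by orientation.\<close>

lemma up_down_sides_meet:
  "sides (up_triangle i j) \<inter> sides (down_triangle k l) \<noteq> {} \<longleftrightarrow>
     k = i \<and> l = j \<or> k = i - 1 \<and> l = j \<or> k = i \<and> l = j - 1"
proof
  assume "sides (up_triangle i j) \<inter> sides (down_triangle k l) \<noteq> {}"
  then obtain a b where "a \<noteq> b" "a \<in> up_triangle i j" "b \<in> up_triangle i j"
    "a \<in> down_triangle k l" "b \<in> down_triangle k l" unfolding sides_meet_iff by blast
  then show "k = i \<and> l = j \<or> k = i - 1 \<and> l = j \<or> k = i \<and> l = j - 1"
    unfolding triangle_defs by (elim insertE emptyE) simp_all
next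
  assume "k = i \<and> l = j \<or> k = i - 1 \<and> l = j \<or> k = i \<and> l = j - 1"
  then have "{(i + 1, j), (i, j + 1)} \<in> sides (up_triangle i j) \<inter> sides (down_triangle k l) \<or>
      {(i, j), (i, j + 1)} \<in> sides (up_triangle i j) \<inter> sides (down_triangle k l) \<or>
      {(i, j), (i + 1, j)} \<in> sides (up_triangle i j) \<inter> sides (down_triangle k l)"
    by (elim disjE conjE) (simp_all add: sides_def triangle_defs)
  then show "sides (up_triangle i j) \<inter> sides (down_triangle k l) \<noteq> {}" by blast
qed

lemma up_neq_down: "up_triangle i j \<noteq> down_triangle k l"
proof
  assume "up_triangle i j = down_triangle k l"
  then have "(i, j) \<in> down_triangle k l" "(i + 1, j) \<in> down_triangle k l" "(i, j + 1) \<in> down_triangle k l"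
    by (auto simp: up_triangle_def)
  then show False by (auto simp: down_triangle_def)
qed

lemma edge_adjacent_sym: "edge_adjacent t u \<longleftrightarrow> edge_adjacent u t"
  by (auto simp: edge_adjacent_def)

lemma edge_adjacent_triangles:
  "\<not> edge_adjacent (up_triangle i j) (up_triangle k l)"
  "\<not> edge_adjacent (down_triangle i j) (down_triangle k l)"
  "edge_adjacent (up_triangle i j) (down_triangle k l) \<longleftrightarrow>
     k = i \<and> l = j \<or> k = i - 1 \<and> l = j \<or> k = i \<and> l = j - 1"
  "edge_adjacent (down_triangle k l) (up_triangle i j) \<longleftrightarrow>
     k = i \<and> l = j \<or> k = i - 1 \<and> l = j \<or> k = i \<and> l = j - 1"
proof -
  show "\<not> edge_adjacent (up_triangle i j) (up_triangle k l)"
    "\<not> edge_adjacent (down_triangle i j) (down_triangle k l)"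
    using up_up_sides_meet[of i j k l] down_down_sides_meet[of i j k l]
    by (auto simp: edge_adjacent_def)
  show "edge_adjacent (up_triangle i j) (down_triangle k l) \<longleftrightarrow>
     k = i \<and> l = j \<or> k = i - 1 \<and> l = j \<or> k = i \<and> l = j - 1"
    unfolding edge_adjacent_def up_down_sides_meet by (simp add: up_neq_down)
  then show "edge_adjacent (down_triangle k l) (up_triangle i j) \<longleftrightarrow>
     k = i \<and> l = j \<or> k = i - 1 \<and> l = j \<or> k = i \<and> l = j - 1"
    by (subst edge_adjacent_sym)
qed

lemma neighbours_up:
  "{u \<in> lattice_triangles. edge_adjacent (up_triangle i j) u} =
     {down_triangle i j, down_triangle (i - 1) j, down_triangle i (j - 1)}" (is "?L = ?R")
proof
  show "?L \<subseteq> ?R"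
  proof
    fix u assume u: "u \<in> ?L"
    then obtain k l where "u = up_triangle k l \<or> u = down_triangle k l"
      by (auto simp: lattice_triangles_eq)
    then show "u \<in> ?R" using u edge_adjacent_triangles by auto
  qed
  show "?R \<subseteq> ?L" by (auto simp: edge_adjacent_triangles lattice_triangles_eq)
qed

lemma neighbours_down:
  "{u \<in> lattice_triangles. edge_adjacent (down_triangle i j) u} =
     {up_triangle i j, up_triangle (i + 1) j, up_triangle i (j + 1)}" (is "?L = ?R")
proof
  show "?L \<subseteq> ?R"
  proof
    fix u assume u: "u \<in> ?L"
    then obtain k l where "u = up_triangle k l \<or> u = down_triangle k l"
      by (auto simp: lattice_triangles_eq)
    then show "u \<in> ?R" using u edge_adjacent_triangles by auto
  qed
  show "?R \<subseteq> ?L" by (auto simp: edge_adjacent_triangles lattice_triangles_eq)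
qed

text \<open>Each \<open>oi\<close> is the reflection of the central corner \<open>ui\<close> in the
  opposite side, for instance \<open>o1 = u2 + u3 - u1\<close> in coordinates.\<close>

lemma triangle_tetriamond_shape:
  assumes t: "t \<in> lattice_triangles"
  obtains u1 u2 u3 o1 o2 o3 where "distinct [u1, u2, u3, o1, o2, o3]"
    "triangle_tetriamond t = {{u1, u2, u3}, {o1, u2, u3}, {o2, u1, u3}, {o3, u1, u2}}"
  using t
proof (cases rule: lattice_triangle_cases)
  case (1 i j)
  show ?thesis
    by (rule that[of "(i, j)" "(i + 1, j)" "(i, j + 1)" "(i + 1, j + 1)" "(i - 1, j + 1)" "(i + 1, j - 1)"])
      (simp_all add: triangle_tetriamond_def 1 neighbours_up, simp add: triangle_defs insert_commute)
next
  case (2 i j)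
  show ?thesis
    by (rule that[of "(i + 1, j + 1)" "(i, j + 1)" "(i + 1, j)" "(i, j)" "(i + 1 + 1, j)" "(i, j + 1 + 1)"])
      (simp_all add: triangle_tetriamond_def 2 neighbours_down, simp add: triangle_defs insert_commute)
qed

lemma finite_neighbours:
  assumes "t \<in> lattice_triangles"
  shows "finite {u \<in> lattice_triangles. edge_adjacent t u}"
  using assms by (cases rule: lattice_triangle_cases) (simp_all add: neighbours_up neighbours_down)

lemma polyiamond_triangle_tetriamond:
  assumes t: "t \<in> lattice_triangles"
  shows "polyiamond (triangle_tetriamond t)"
proof -
  let ?P = "triangle_tetriamond t"
  let ?R = "{(a, b). a \<in> ?P \<and> b \<in> ?P \<and> edge_adjacent a b}"
  have "(a, t) \<in> ?R\<^sup>* \<and> (t, a) \<in> ?R\<^sup>*" if a: "a \<in> ?P" for a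
  proof (cases "a = t")
    case False
    then have "edge_adjacent t a" "edge_adjacent a t"
      using a edge_adjacent_sym[of t a] by (auto simp: triangle_tetriamond_def)
    moreover have "t \<in> ?P" by (simp add: triangle_tetriamond_def)
    ultimately show ?thesis using a by (intro conjI r_into_rtrancl) simp_all
  qed simp
  then have "(a, b) \<in> ?R\<^sup>*" if "a \<in> ?P" "b \<in> ?P" for a b
    using that by (meson rtrancl_trans)
  then show ?thesis
    using t finite_neighbours[OF t] unfolding polyiamond_def
    by (intro conjI ballI) (auto simp: triangle_tetriamond_def)
qed

text \<open>The first step of a connecting path from \<open>t\<close> to \<open>u\<close>.\<close>

lemma polyiamond_neighbour:
  assumes P: "polyiamond P" and tu: "t \<in> P" "u \<in> P" "t \<noteq> u"
  shows "\<exists>w\<in>P - {t}. edge_adjacent t w"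
proof -
  have "(t, u) \<in> {(a, b). a \<in> P \<and> b \<in> P \<and> edge_adjacent a b}\<^sup>*"
    using P tu by (simp add: polyiamond_def)
  then obtain w where "w \<in> P" "edge_adjacent t w"
    using tu(3) by (cases rule: converse_rtranclE) auto
  moreover have "w \<noteq> t" using \<open>edge_adjacent t w\<close> by (auto simp: edge_adjacent_def)
  ultimately show ?thesis by blast
qed

section \<open>Polyiamonds with fewer than four triangles\<close>

lemma card_lattice_triangle:
  assumes "t \<in> lattice_triangles"
  shows "card t = 3"
  using assms by (cases rule: lattice_triangle_cases) (simp_all add: triangle_defs)

lemma finite_lattice_triangle: "t \<in> lattice_triangles \<Longrightarrow> finite t"
  using card_lattice_triangle by (intro card_ge_0_finite) simp

lemma edge_adjacent_card_Int:
  assumes "t \<in> lattice_triangles" "edge_adjacent t u"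
  shows "card (t \<inter> u) \<ge> 2"
proof -
  obtain a b where "a \<noteq> b" "{a, b} \<subseteq> t \<inter> u"
    using assms(2) unfolding edge_adjacent_def sides_meet_iff by auto
  then show ?thesis
    using card_mono[of "t \<inter> u" "{a, b}"] finite_lattice_triangle[OF assms(1)] by simp
qed

text \<open>Each neighbour shares at least two of the three corners of \<open>t\<close>, and two
  such pairs of corners overlap.\<close>

lemma common_corner:
  assumes t: "t \<in> lattice_triangles" "edge_adjacent t u" "edge_adjacent t w"
  obtains v where "v \<in> t" "v \<in> u" "v \<in> w"
proof -
  define A where "A = t \<inter> u"
  define B where "B = t \<inter> w"
  have sub: "A \<union> B \<subseteq> t" and fin: "finite A" "finite B"
    using finite_lattice_triangle[OF t(1)] by (auto simp: A_def B_def)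
  have "card (A \<union> B) \<le> 3"
    using card_mono[OF finite_lattice_triangle[OF t(1)] sub] card_lattice_triangle[OF t(1)] by simp
  moreover have "card A + card B = card (A \<union> B) + card (A \<inter> B)"
    using fin by (rule card_Un_Int)
  moreover have "card A \<ge> 2" "card B \<ge> 2"
    unfolding A_def B_def using t by (auto intro: edge_adjacent_card_Int)
  ultimately have "card (A \<inter> B) \<noteq> 0" by linarith
  then have "A \<inter> B \<noteq> {}" by (metis card.empty)
  then show ?thesis using that unfolding A_def B_def by blast
qed

lemma small_polyiamond_common_corner:
  assumes P: "polyiamond P" and card: "card P < 4"
  obtains v where "\<And>p. p \<in> P \<Longrightarrow> v \<in> p"
proof -
  have fin: "finite P" and ne: "P \<noteq> {}" and lat: "\<And>p. p \<in> P \<Longrightarrow> p \<in> lattice_triangles"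
    using P unfolding polyiamond_def by blast+
  have "card P > 0" using fin ne by (simp add: card_gt_0_iff)
  then consider "card P = 1" | "card P = 2" | "card P = 3" using card by linarith
  \<comment> \<open>Some \<open>t\<close> is adjacent to all other triangles: with three triangles
    and none isolated, one of them neighbours both others. A single triangle is covered by
    \<open>u = t\<close> and \<open>w = t\<close>.\<close>
  then have "\<exists>t\<in>P. \<exists>u w. P \<subseteq> {t, u, w} \<and> (edge_adjacent t u \<and> edge_adjacent t w \<or> u = t \<and> w = t)"
  proof cases
    case 1
    then obtain t where "P = {t}" by (auto simp: card_1_singleton_iff)
    then show ?thesis by (intro bexI[of _ t] exI[of _ t]) simp_all
  next
    case 2
    then obtain t u where tu: "P = {t, u}" "t \<noteq> u" by (auto simp: card_2_iff)
    then have "edge_adjacent t u" using polyiamond_neighbour[OF P, of t u] by auto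
    then show ?thesis unfolding tu(1) by (intro bexI[of _ t] exI[of _ u]) simp_all
  next
    case 3
    then obtain t u w where tuw: "P = {t, u, w}" "t \<noteq> u" "u \<noteq> w" "t \<noteq> w"
      by (auto simp: card_3_iff)
    have "edge_adjacent t u \<or> edge_adjacent t w"
      using polyiamond_neighbour[OF P, of t u] tuw by auto
    moreover have "edge_adjacent u t \<or> edge_adjacent u w"
      using polyiamond_neighbour[OF P, of u t] tuw by auto
    moreover have "edge_adjacent w t \<or> edge_adjacent w u"
      using polyiamond_neighbour[OF P, of w t] tuw by auto
    ultimately have "edge_adjacent t u \<and> edge_adjacent t w \<or> edge_adjacent u t \<and> edge_adjacent u w \<or>
        edge_adjacent w t \<and> edge_adjacent w u"
      using edge_adjacent_sym[of t u] edge_adjacent_sym[of t w] edge_adjacent_sym[of u w] by argo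
    then consider "edge_adjacent t u" "edge_adjacent t w" | "edge_adjacent u t" "edge_adjacent u w"
      | "edge_adjacent w t" "edge_adjacent w u" by blast
    then show ?thesis
    proof cases
      case 1
      then show ?thesis unfolding tuw(1) by (intro bexI[of _ t] exI[of _ u] exI[of _ w]) auto
    next
      case 2
      then show ?thesis unfolding tuw(1) by (intro bexI[of _ u] exI[of _ t] exI[of _ w]) auto
    next
      case 3
      then show ?thesis unfolding tuw(1) by (intro bexI[of _ w] exI[of _ t] exI[of _ u]) auto
    qed
  qed
  then obtain t u w where t: "t \<in> P" "P \<subseteq> {t, u, w}"
    "edge_adjacent t u \<and> edge_adjacent t w \<or> u = t \<and> w = t" by blast
  have "\<exists>v. v \<in> t \<and> v \<in> u \<and> v \<in> w"
  proof (cases "edge_adjacent t u \<and> edge_adjacent t w")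
    case True
    then show ?thesis using common_corner[OF lat[OF t(1)], of u w] by blast
  next
    case False
    moreover have "t \<noteq> {}" using card_lattice_triangle[OF lat[OF t(1)]] by auto
    ultimately show ?thesis using t(3) by auto
  qed
  then obtain v where "v \<in> t" "v \<in> u" "v \<in> w" by blast
  then have "v \<in> p" if "p \<in> P" for p using that t(2) by auto
  then show thesis by (rule that)
qed

section \<open>Counting the sides of a polyiamond\<close>

lemma card_sides:
  assumes "t \<in> lattice_triangles"
  shows "card (sides t) = 3"
  unfolding sides_def
  by (simp add: n_subsets[OF finite_lattice_triangle[OF assms]] card_lattice_triangle[OF assms] choose_two)

lemma card_disjoint_sides:
  assumes "finite T" "T \<subseteq> lattice_triangles" "\<And>t u. t \<in> T \<Longrightarrow> u \<in> T \<Longrightarrow> t \<noteq> u \<Longrightarrow> sides t \<inter> sides u = {}"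
  shows "card (\<Union>t\<in>T. sides t) = 3 * card T"
proof -
  have "finite (sides t)" if "t \<in> T" for t
    using card_sides[of t] that assms(2) by (intro card_ge_0_finite) auto
  then have "card (\<Union>t\<in>T. sides t) = (\<Sum>t\<in>T. card (sides t))"
    using assms by (intro card_UN_disjoint) auto
  also have "\<dots> = (\<Sum>t\<in>T. 3)" using assms(2) card_sides by (intro sum.cong) auto
  finally show ?thesis by simp
qed

text \<open>Two different sides of a triangle already span all its corners, so sharing both would
  make the triangles equal.\<close>

lemma card_sides_Int:
  assumes "t \<in> lattice_triangles" "u \<in> lattice_triangles" "t \<noteq> u"
  shows "card (sides t \<inter> sides u) \<le> 1"
proof (rule ccontr)
  have fin: "finite (sides t)" using card_sides[OF assms(1)] by (intro card_ge_0_finite) simp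
  assume "\<not> ?thesis"
  then obtain e f where ef: "e \<in> sides t \<inter> sides u" "f \<in> sides t \<inter> sides u" "e \<noteq> f"
    using fin card_le_Suc0_iff_eq[of "sides t \<inter> sides u"] by auto
  have ft: "finite t" "finite u"
    using assms by (simp_all add: finite_lattice_triangle)
  have c: "card e = 2" "card f = 2" "e \<union> f \<subseteq> t" "e \<union> f \<subseteq> u" using ef by (auto simp: sides_def)
  have fe: "finite e" "finite f" using c by (auto intro: finite_subset[OF _ ft(1)])
  have "\<not> f \<subseteq> e" using ef(3) c(1,2) fe card_subset_eq[of e f] by auto
  then have "e \<subset> e \<union> f" by blast
  then have "card (e \<union> f) > 2" using psubset_card_mono[of "e \<union> f" e] fe c by simp
  then have "t = e \<union> f" "u = e \<union> f"
    using c(3,4) ft card_lattice_triangle[OF assms(1)] card_lattice_triangle[OF assms(2)]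
    by (metis card_seteq Suc_leI eval_nat_numeral(3))+
  then show False using assms(3) by simp
qed

text \<open>Triangles of equal orientation have no common sides, so three of them already have nine. Of two
  triangles of each orientation, not all four pairs of opposite orientation are adjacent.\<close>

lemma card_qubits_ge_9:
  assumes fin: "finite P" and lat: "P \<subseteq> lattice_triangles" and card: "card P \<ge> 4"
  shows "card (qubits P) \<ge> 9"
proof -
  define A where "A = {t \<in> P. \<exists>i j. t = up_triangle i j}"
  define B where "B = {t \<in> P. \<exists>i j. t = down_triangle i j}"
  have "P = A \<union> B" using lat unfolding A_def B_def lattice_triangles_eq by blast
  moreover have "A \<inter> B = {}" unfolding A_def B_def using up_neq_down by blast
  ultimately have AB: "P = A \<union> B" "A \<inter> B = {}" "finite A" "finite B"
    "A \<subseteq> lattice_triangles" "B \<subseteq> lattice_triangles" using fin lat by auto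
  have cA: "card (\<Union>t\<in>A. sides t) = 3 * card A"
  proof (rule card_disjoint_sides[OF AB(3,5)])
    fix t u assume "t \<in> A" "u \<in> A" "t \<noteq> u"
    then obtain i j k l where "t = up_triangle i j" "u = up_triangle k l" unfolding A_def by blast
    then show "sides t \<inter> sides u = {}" using \<open>t \<noteq> u\<close> up_up_sides_meet[of i j k l] by auto
  qed
  have cB: "card (\<Union>t\<in>B. sides t) = 3 * card B"
  proof (rule card_disjoint_sides[OF AB(4,6)])
    fix t u assume "t \<in> B" "u \<in> B" "t \<noteq> u"
    then obtain i j k l where "t = down_triangle i j" "u = down_triangle k l" unfolding B_def by blast
    then show "sides t \<inter> sides u = {}" using \<open>t \<noteq> u\<close> down_down_sides_meet[of i j k l] by auto
  qed
  have finS: "finite (sides t)" if "t \<in> P" for t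
    using card_sides[of t] that lat by (intro card_ge_0_finite) auto
  have q: "qubits P = (\<Union>t\<in>A. sides t) \<union> (\<Union>t\<in>B. sides t)" unfolding qubits_def by (subst AB(1)) (rule UN_Un)
  have fq: "finite (\<Union>t\<in>A. sides t)" "finite (\<Union>t\<in>B. sides t)" using AB finS by auto
  have ge: "card (qubits P) \<ge> 3 * card A" "card (qubits P) \<ge> 3 * card B"
    unfolding q cA[symmetric] cB[symmetric] using fq by (auto intro: card_mono)
  have "card A + card B \<ge> 4" using card AB by (metis card_Un_disjoint)
  then consider "card A \<ge> 3" | "card B \<ge> 3" | "card A = 2" "card B = 2" by linarith
  then show ?thesis
  proof cases
    case 3
    then obtain t t' u u' where tu: "A = {t, t'}" "t \<noteq> t'" "B = {u, u'}" "u \<noteq> u'"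
      by (auto simp: card_2_iff)
    have le1: "card (sides a \<inter> sides b) \<le> 1" if "a \<in> A" "b \<in> B" for a b
      using that AB by (intro card_sides_Int) auto
    \<comment> \<open>Otherwise the four triangles would form a 4-cycle in the honeycomb dual graph;
      the coordinates rule this out.\<close>
    have "\<exists>a\<in>A. \<exists>b\<in>B. sides a \<inter> sides b = {}"
    proof (rule ccontr)
      assume "\<not> ?thesis"
      then have all: "sides t \<inter> sides u \<noteq> {}" "sides t \<inter> sides u' \<noteq> {}"
        "sides t' \<inter> sides u \<noteq> {}" "sides t' \<inter> sides u' \<noteq> {}" using tu by auto
      have "t \<in> A" "t' \<in> A" "u \<in> B" "u' \<in> B" using tu by simp_all
      then obtain i j i' j' k l k' l' where
          eqs: "t = up_triangle i j" "t' = up_triangle i' j'" "u = down_triangle k l" "u' = down_triangle k' l'"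
        unfolding A_def B_def by blast
      have "i \<noteq> i' \<or> j \<noteq> j'" "k \<noteq> k' \<or> l \<noteq> l'" using tu(2,4) unfolding eqs by auto
      then show False using all unfolding eqs up_down_sides_meet by smt
    qed
    then obtain a b where ab: "a \<in> A" "b \<in> B" "sides a \<inter> sides b = {}" by blast
    \<comment> \<open>The remaining three pairs share at most one side each, so at least 6 + 6 - 3 =
      9 sides are distinct.\<close>
    have "(\<Union>t\<in>A. sides t) \<inter> (\<Union>t\<in>B. sides t) = (\<Union>(x, y)\<in>A \<times> B - {(a, b)}. sides x \<inter> sides y)"
      using ab by auto
    also have "card \<dots> \<le> (\<Sum>(x, y)\<in>A \<times> B - {(a, b)}. card (sides x \<inter> sides y))"
      unfolding split_beta using AB by (intro card_UN_le) auto
    also have "\<dots> \<le> (\<Sum>(x, y)\<in>A \<times> B - {(a, b)}. 1)"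
      using le1 by (intro sum_mono) auto
    also have "\<dots> = 3" using 3 ab AB by (simp add: split_beta card_cartesian_product)
    finally have "card ((\<Union>t\<in>A. sides t) \<inter> (\<Union>t\<in>B. sides t)) \<le> 3" .
    moreover have "card (qubits P) + card ((\<Union>t\<in>A. sides t) \<inter> (\<Union>t\<in>B. sides t)) = 12"
      unfolding q using card_Un_Int[OF fq] cA cB 3 by simp
    ultimately show ?thesis by simp
  qed (use ge in auto)
qed

section \<open>Polyiamonds whose triangles share a corner\<close>

text \<open>The edges at the common corner \<open>v\<close> form a spanning tree whose fundamental cycles are the
  triangles. Hadamard gates off the tree turn the star at \<open>a \<noteq> v\<close> into the graph stabilizer of the
  edge \<open>{v, a}\<close>, and the plaquette of a triangle into that of its side opposite to \<open>v\<close>.\<close>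

lemma common_corner_local_graph_state:
  assumes P: "polyiamond P" and v: "\<And>p. p \<in> P \<Longrightarrow> v \<in> p" and \<psi>: "toric_ground_state P \<psi>"
  shows "\<exists>E \<phi>. simple_graph (qubits P) E \<and> graph_state (qubits P) E \<phi> \<and>
           LC_equivalent (qubits P) \<psi> \<phi> \<and> local_graph P E"
proof -
  let ?Q = "qubits P"
  \<comment> \<open>A bipartite graph: each edge avoiding \<open>v\<close> is joined to the edges at
    \<open>v\<close> that meet it, so every graph edge is vicinal by a shared corner.\<close>
  define E where "E = {(e, f). e \<in> ?Q \<and> f \<in> ?Q \<and> (v \<in> e) \<noteq> (v \<in> f) \<and> e \<inter> f \<noteq> {}}"
  define U where "U = (\<lambda>e :: point set. if v \<in> e then mat 1 else hadamard)"
  define \<phi> where "\<phi> = tensor_apply ?Q U \<psi>"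
  have fin: "finite ?Q" by (rule finite_qubits[OF P])
  have spoke: "\<exists>a. e = {v, a} \<and> a \<noteq> v" if e: "e \<in> ?Q" "v \<in> e" for e
  proof -
    obtain a b where "e = {a, b}" "a \<noteq> b" by (rule qubits_doubleton[OF P e(1)])
    then show ?thesis using e(2) by (metis insertE insert_commute singletonD)
  qed
  \<comment> \<open>The triangle containing \<open>e\<close> also contains \<open>v\<close>, so it
    consists of \<open>v\<close> and the endpoints of \<open>e\<close>.\<close>
  have rim: "\<exists>a b. e = {a, b} \<and> distinct [v, a, b] \<and> {v, a} \<in> ?Q \<and> {v, b} \<in> ?Q"
    if e: "e \<in> ?Q" "v \<notin> e" for e
  proof -
    obtain p where p: "p \<in> P" "e \<in> sides p" using e(1) unfolding qubits_def by blast
    obtain a b where ab: "e = {a, b}" "a \<noteq> b" by (rule qubits_doubleton[OF P e(1)])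
    have "{v, a} \<in> sides p" "{v, b} \<in> sides p"
      using p v[OF p(1)] ab e(2) by (simp_all add: sides_def card_insert_if)
    then have "{v, a} \<in> ?Q" "{v, b} \<in> ?Q" using p(1) unfolding qubits_def by blast+
    moreover have "distinct [v, a, b]" using ab e(2) by simp
    ultimately show ?thesis using ab(1) by blast
  qed
  have corner: "a \<in> corners P" if "e \<in> ?Q" "a \<in> e" for e a
    using that unfolding qubits_def sides_def corners_def by blast
  have simple: "simple_graph ?Q E" by (auto simp: simple_graph_def E_def sym_def irrefl_def)
  have Uc: "U e \<in> clifford_group" for e
    by (simp add: U_def hadamard_in_clifford_group one_in_clifford_group)
  have "local_graph P E"
    unfolding local_graph_def
  proof (rule ballI, clarify)
    fix e f assume "(e, f) \<in> E"
    then obtain s where "e \<in> ?Q" "f \<in> ?Q" "e \<noteq> f" "s \<in> e" "s \<in> f" by (auto simp: E_def)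
    then show "vicinal P e f" using corner[of e s] by (auto simp: vicinal_def star_def)
  qed
  moreover have "LC_equivalent ?Q \<psi> \<phi>"
    unfolding LC_equivalent_def \<phi>_def by (rule exI[of _ U]) (simp add: Uc)
  moreover have "graph_state ?Q E \<phi>"
    unfolding graph_state_def
  proof (intro conjI ballI)
    show "is_state ?Q \<phi>"
      unfolding \<phi>_def using Uc \<psi>
      by (intro is_state_tensor_apply[OF fin]) (auto simp: clifford_group_def toric_ground_state_def)
    fix e assume e: "e \<in> ?Q"
    \<comment> \<open>It suffices to find a stabilizer \<open>g\<close> of \<open>\<psi>\<close>
      that \<open>U\<close> carries qubitwise to the generator at \<open>e\<close>: a star if
      \<open>e\<close> contains \<open>v\<close>, a plaquette otherwise.\<close>
    have "\<exists>g. tensor_apply ?Q g \<psi> = \<psi> \<and> (\<forall>i\<in>?Q. graph_stabilizer E e i ** U i = U i ** g i)"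
    proof (cases "v \<in> e")
      case True
      then obtain a where a: "e = {v, a}" "a \<noteq> v" using spoke[OF e] by blast
      have "tensor_apply ?Q (x_on (star P a)) \<psi> = \<psi>"
        using \<psi> corner[OF e, of a] a by (simp add: toric_ground_state_def)
      moreover have "graph_stabilizer E e i ** U i = U i ** x_on (star P a) i" if i: "i \<in> ?Q" for i
      proof (cases "v \<in> i")
        case vi: True
        then have "i \<in> star P a \<longleftrightarrow> i = e" using spoke[OF i] i a by (auto simp: star_def)
        moreover have "(e, i) \<notin> E" using True vi by (simp add: E_def)
        ultimately show ?thesis using vi by (simp add: graph_stabilizer_def x_on_def z_on_def U_def)
      next
        case vi: False
        then have "i \<in> star P a \<longleftrightarrow> (e, i) \<in> E" using i e a by (auto simp: star_def E_def)
        moreover have "i \<noteq> e" using True vi by blast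
        ultimately show ?thesis using vi
          by (simp add: graph_stabilizer_def x_on_def z_on_def U_def sigma_hadamard)
      qed
      ultimately show ?thesis by blast
    next
      case False
      then obtain a b where ab: "e = {a, b}" "distinct [v, a, b]" "{v, a} \<in> ?Q" "{v, b} \<in> ?Q"
        using rim[OF e] by blast
      let ?C = "{{v, a}, {v, b}, {a, b}}"
      have "?C \<in> cycles P" using ab e by (intro triangle_cycle) auto
      then have "tensor_apply ?Q (z_on ?C) \<psi> = \<psi>" using \<psi> by (simp add: toric_ground_state_def)
      moreover have "graph_stabilizer E e i ** U i = U i ** z_on ?C i" if i: "i \<in> ?Q" for i
      proof (cases "v \<in> i")
        case vi: True
        then obtain c where "i = {v, c}" "c \<noteq> v" using spoke[OF i] by blast
        then have "i \<in> ?C \<longleftrightarrow> (e, i) \<in> E" using i e ab by (auto simp: E_def doubleton_eq_iff)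
        moreover have "i \<noteq> e" using False vi by blast
        ultimately show ?thesis using vi by (simp add: graph_stabilizer_def x_on_def z_on_def U_def)
      next
        case vi: False
        then have "i \<in> ?C \<longleftrightarrow> i = e" using ab by auto
        moreover have "(e, i) \<notin> E" using False vi by (simp add: E_def)
        ultimately show ?thesis using vi
          by (simp add: graph_stabilizer_def x_on_def z_on_def U_def sigma_hadamard)
      qed
      ultimately show ?thesis by blast
    qed
    then obtain g where g: "tensor_apply ?Q g \<psi> = \<psi>"
      "\<And>i. i \<in> ?Q \<Longrightarrow> graph_stabilizer E e i ** U i = U i ** g i" by blast
    have "tensor_apply ?Q (graph_stabilizer E e) \<phi> = tensor_apply ?Q (\<lambda>i. U i ** g i) \<psi>"
      unfolding \<phi>_def tensor_apply_compose[OF fin] by (rule tensor_apply_cong) (rule g(2))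
    also have "\<dots> = tensor_apply ?Q U (tensor_apply ?Q g \<psi>)"
      by (rule tensor_apply_compose[OF fin, symmetric])
    finally show "tensor_apply ?Q (graph_stabilizer E e) \<phi> = \<phi>" by (simp add: g(1) \<phi>_def)
  qed
  ultimately show ?thesis using simple by blast
qed

theorem mainTheorem3:
  shows
    "(\<forall>t\<in>lattice_triangles.
        polyiamond (triangle_tetriamond t) \<and>
        card (triangle_tetriamond t) = 4 \<and>
        card (qubits (triangle_tetriamond t)) = 9 \<and>
        (\<forall>\<psi> E \<phi>.
           toric_ground_state (triangle_tetriamond t) \<psi> \<and>
           simple_graph (qubits (triangle_tetriamond t)) E \<and>
           graph_state (qubits (triangle_tetriamond t)) E \<phi> \<and>
           LC_equivalent (qubits (triangle_tetriamond t)) \<psi> \<phi> \<longrightarrow>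
           \<not> local_graph (triangle_tetriamond t) E)) \<and>
     (\<forall>P. polyiamond P \<and> (card P < 4 \<or> card (qubits P) < 9) \<longrightarrow>
        (\<forall>\<psi>. toric_ground_state P \<psi> \<longrightarrow>
           (\<exists>E \<phi>. simple_graph (qubits P) E \<and> graph_state (qubits P) E \<phi> \<and>
              LC_equivalent (qubits P) \<psi> \<phi> \<and> local_graph P E)))"
proof (intro conjI ballI allI impI)
  fix t assume t: "t \<in> lattice_triangles"
  let ?P = "triangle_tetriamond t"
  show "polyiamond ?P" by (rule polyiamond_triangle_tetriamond[OF t])
  obtain u1 u2 u3 o1 o2 o3 where dist: "distinct [u1, u2, u3, o1, o2, o3]"
    and P: "?P = {{u1, u2, u3}, {o1, u2, u3}, {o2, u1, u3}, {o3, u1, u2}}"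
    by (rule triangle_tetriamond_shape[OF t])
  have "distinct [o3, o2, o1, u3, u2, u1]" using dist by auto
  note ineq = dist[simplified] this[simplified]
  have "o1 \<notin> {u1, u2, u3}" "o2 \<notin> {u1, u2, u3}" "o3 \<notin> {u1, u2, u3}" "o1 \<notin> {o2, u1, u3}"
    "o1 \<notin> {o3, u1, u2}" "o2 \<notin> {o3, u1, u2}"
    using ineq by simp_all
  then have "distinct [{u1, u2, u3}, {o1, u2, u3}, {o2, u1, u3}, {o3, u1, u2}]"
    unfolding distinct.simps list.set by blast
  then show "card ?P = 4" unfolding P using distinct_card by fastforce
  have "distinct [{u2, u3}, {u1, u3}, {u1, u2}, {o1, u2}, {o1, u3}, {o2, u1}, {o2, u3}, {o3, u1}, {o3, u2}]"
    using ineq by (simp add: doubleton_eq_iff)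
  then show "card (qubits ?P) = 9"
    unfolding P qubits_tetriamond[OF dist] using distinct_card by fastforce
  fix \<psi> E \<phi>
  assume "toric_ground_state ?P \<psi> \<and> simple_graph (qubits ?P) E \<and> graph_state (qubits ?P) E \<phi> \<and>
    LC_equivalent (qubits ?P) \<psi> \<phi>"
  then show "\<not> local_graph ?P E" using tetriamond_not_local[OF dist P] by blast
next
  fix P \<psi>
  assume P: "polyiamond P \<and> (card P < 4 \<or> card (qubits P) < 9)" and \<psi>: "toric_ground_state P \<psi>"
  then have "finite P" "P \<subseteq> lattice_triangles" unfolding polyiamond_def by blast+
  \<comment> \<open>Four triangles already have nine sides, so a bound on the qubits reduces to the
    bound on the triangles.\<close>
  then have "card P < 4" using P card_qubits_ge_9[of P] by linarith
  then obtain v where "\<And>p. p \<in> P \<Longrightarrow> v \<in> p"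
    using small_polyiamond_common_corner[of P] P by blast
  then show "\<exists>E \<phi>. simple_graph (qubits P) E \<and> graph_state (qubits P) E \<phi> \<and>
      LC_equivalent (qubits P) \<psi> \<phi> \<and> local_graph P E"
    using common_corner_local_graph_state P \<psi> by blast
qed

end
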